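(* For every $r\ge1$ and integers $k_1\ge3$, $k_2,\dots,k_r\ge2$, there is an exponent $M\ge0$ such that, locally uniformly for $\tau\in\mathbb{H}$, $$G^{(N)}_{k_1,\dots,k_r}(\tau)-G_{k_1,\dots,k_r}(\tau)=O\!\left(\frac{\mathcal{L}(N)^M}{N^2}\right);$$ that is, for every compact $C\subset\mathbb{H}$ there is a constant $A>0$ with $\left|G^{(N)}_{k_1,\dots,k_r}(\tau)-G_{k_1,\dots,k_r}(\tau)\right|\le A\,\mathcal{L}(N)^M/N^2$ for all $\tau\in C$ and all integers $N\ge1$.
   Context: For $\tau$ in the upper half-plane $\mathbb{H}$ let $\Lambda_\tau=\mathbb{Z}\tau+\mathbb{Z}$. The total order $\succ$ on $\Lambda_\tau$ is: $a_1\tau+b_1\succ a_2\tau+b_2$ iff $a_1>a_2$, or $a_1=a_2$ and $b_1>b_2$. For an integer $N\ge1$ put $H_N(a\tau+b)=Na+b$; the total order $\succ_N$ on $\Lambda_\tau$ is: $a_1\tau+b_1\succ_N a_2\tau+b_2$ iff $H_N(a_1\tau+b_1)>H_N(a_2\tau+b_2)$, or these values are equal and $a_1<a_2$. For $k_1\ge3$, $k_2,\dots,k_r\ge2$ define the absolutely convergent sums $$G_{k_1,\dots,k_r}(\tau)=\sum_{\substack{\lambda_1,\dots,\lambda_r\in\Lambda_\tau\\ \lambda_1\succ\cdots\succ\lambda_r\succ0}}\frac{1}{\lambda_1^{k_1}\cdots\lambda_r^{k_r}},\qquad G^{(N)}_{k_1,\dots,k_r}(\tau)=\sum_{\substack{\lambda_1,\dots,\lambda_r\in\Lambda_\tau\\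 \lambda_1\succ_N\cdots\succ_N\lambda_r\succ_N0}}\frac{1}{\lambda_1^{k_1}\cdots\lambda_r^{k_r}}.$$ For $t\ge0$, $\mathcal{L}(t)=1+\log(2+t)$. *)

theory Defs
  imports "HOL-Analysis.Analysis"
begin

definition upper_half_plane :: "complex set" where
  "upper_half_plane = {\<tau>. Im \<tau> > 0}"

definition lattice_point :: "complex \<Rightarrow> int \<Rightarrow> int \<Rightarrow> complex" where
  "lattice_point \<tau> a b = of_int a * \<tau> + of_int b"

definition lattice :: "complex \<Rightarrow> complex set" where
  "lattice \<tau> = {lattice_point \<tau> a b | a b. True}"

text \<open>
  The two orders are relations on the lattice points themselves, and never hold outside the
  lattice. For \<open>Im \<tau> > 0\<close> the coordinates of a lattice point are unique, so the existential
  quantifiers merely name them; see \<open>lattice_gt_iff\<close> and \<open>lattice_gtN_iff\<close>.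
\<close>

definition lattice_gt :: "complex \<Rightarrow> complex \<Rightarrow> complex \<Rightarrow> bool" where
  "lattice_gt \<tau> x y \<longleftrightarrow>
     (\<exists>a1 b1 a2 b2. x = lattice_point \<tau> a1 b1 \<and> y = lattice_point \<tau> a2 b2 \<and>
        (a1 > a2 \<or> (a1 = a2 \<and> b1 > b2)))"

definition height :: "nat \<Rightarrow> int \<Rightarrow> int \<Rightarrow> int" where
  "height N a b = int N * a + b"

text \<open>Ties in height are broken by \<^emph>\<open>smaller\<close> \<open>\<tau>\<close>-coordinate.\<close>

definition lattice_gtN :: "nat \<Rightarrow> complex \<Rightarrow> complex \<Rightarrow> complex \<Rightarrow> bool" where
  "lattice_gtN N \<tau> x y \<longleftrightarrow>
     (\<exists>a1 b1 a2 b2. x = lattice_point \<tau> a1 b1 \<and> y = lattice_point \<tau> a2 b2 \<and>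
        (height N a1 b1 > height N a2 b2 \<or>
         (height N a1 b1 = height N a2 b2 \<and> a1 < a2)))"

lemma lattice_point_eq_iff:
  assumes "Im \<tau> > 0"
  shows "lattice_point \<tau> a b = lattice_point \<tau> c d \<longleftrightarrow> a = c \<and> b = d"
  using assms by (auto simp: lattice_point_def complex_eq_iff)

lemma lattice_gt_iff:
  assumes "Im \<tau> > 0"
  shows "lattice_gt \<tau> (lattice_point \<tau> a1 b1) (lattice_point \<tau> a2 b2) \<longleftrightarrow>
           a1 > a2 \<or> (a1 = a2 \<and> b1 > b2)"
  unfolding lattice_gt_def lattice_point_eq_iff[OF assms] by blast

lemma lattice_gtN_iff:
  assumes "Im \<tau> > 0"
  shows "lattice_gtN N \<tau> (lattice_point \<tau> a1 b1) (lattice_point \<tau> a2 b2) \<longleftrightarrow>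
           height N a1 b1 > height N a2 b2 \<or>
           (height N a1 b1 = height N a2 b2 \<and> a1 < a2)"
  unfolding lattice_gtN_def lattice_point_eq_iff[OF assms] by blast

text \<open>
  The tuples \<open>(\<lambda>\<^sub>1, \<dots>, \<lambda>\<^sub>r)\<close> of lattice points with \<open>\<lambda>\<^sub>1 \<succ> \<dots> \<succ> \<lambda>\<^sub>r \<succ> 0\<close>, as lists; the index
  \<open>i\<close> of the mathematics is the list position \<open>i - 1\<close>.
\<close>

definition chains :: "(complex \<Rightarrow> complex \<Rightarrow> bool) \<Rightarrow> complex \<Rightarrow> nat \<Rightarrow> complex list set" where
  "chains gt \<tau> r =
     {ls. length ls = r \<and> set ls \<subseteq> lattice \<tau> \<and> successively gt (ls @ [0])}"

text \<open>
  Unordered summation of complex numbers is the same as absolutely convergent summation.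
\<close>

definition multiple_Eisenstein :: "nat list \<Rightarrow> complex \<Rightarrow> complex" where
  "multiple_Eisenstein ks \<tau> =
     (\<Sum>\<^sub>\<infinity>ls\<in>chains (lattice_gt \<tau>) \<tau> (length ks). 1 / (\<Prod>i<length ks. (ls ! i) ^ (ks ! i)))"

definition multiple_Eisenstein_N :: "nat \<Rightarrow> nat list \<Rightarrow> complex \<Rightarrow> complex" where
  "multiple_Eisenstein_N N ks \<tau> =
     (\<Sum>\<^sub>\<infinity>ls\<in>chains (lattice_gtN N \<tau>) \<tau> (length ks). 1 / (\<Prod>i<length ks. (ls ! i) ^ (ks ! i)))"

definition log_factor :: "real \<Rightarrow> real" where
  "log_factor t = 1 + ln (2 + t)"

end

theory Submission
  imports Defs
begin

text \<open>
  Truncating all \<open>\<lambda>\<^sub>i\<close> to a box of side polynomial in \<open>N\<close> costs \<open>O(N\<^sup>-\<^sup>2)\<close>, and inside the box every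
  sum of \<open>|\<lambda>|\<^sup>-\<^sup>2\<close> is logarithmic. The two orders disagree on \<open>\<lambda>\<close> and \<open>\<mu>\<close> only if \<open>\<lambda> - \<mu> = a \<tau> + b\<close> with
  \<open>|b| \<ge> N |a| > 0\<close>, which forces a large coordinate and gains a factor \<open>1/N\<close>. A second gain of
  \<open>1/N\<close> comes from \<open>k\<^sub>1 \<ge> 3\<close> if \<open>\<lambda>\<^sub>1\<close> is large, or from another large \<open>\<lambda>\<^sub>i\<close>.

  If exactly one \<open>\<lambda>\<^sub>j\<close> with \<open>j \<ge> 2\<close> is large, absolute values only give \<open>1/N\<close> and cancellation is
  needed. For \<open>p \<succ> q\<close> the indicator of \<open>p \<succ> x \<succ> q\<close> is \<open>[p \<succ> x] + [x \<succ> q] - 1\<close>, so the difference of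
  the two sums over \<open>x = \<lambda>\<^sub>j\<close> is \<open>T(q) - T(p)\<close>, where \<open>T(p)\<close> sums \<open>([x \<succ>\<^sub>N p] - [x \<succ> p]) / x\<^sup>k\<close>.
  Here \<open>T(0)\<close> vanishes for even \<open>k\<close> by the symmetry \<open>x \<mapsto> -x\<close> and is \<open>O(log\<^sup>2 N / N\<^sup>2)\<close> for odd \<open>k\<close>,
  while shifting by \<open>p\<close> changes \<open>T\<close> by \<open>O(|p| log\<^sup>2 N / N\<^sup>2)\<close> only.
\<close>

section \<open>Sums over tuples\<close>

text \<open>With exponent 2, a member being large gains nothing by itself: the sum of
  \<open>|\<lambda>|\<close>^-2 over the large points of the box is still logarithmic. The gain
  comes from confinement. In a chain for the lexicographic order all first coordinates lie between 0
  and that of \<open>P 0\<close>, so a large member has only its second coordinate free. In a chain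
  for the other order the same holds unless the member lies in the wedge around 0 or around
  \<open>P 0\<close>, which is rare as well. The price is a factor of the size of the first
  coordinate of \<open>P 0\<close>, and the spare power in the exponent of \<open>P 0\<close> can
  pay it once. In the cancellation case the same spare power pays for the factor |p|, where p is a
  neighbour of the lone large point; p is confined to the strip too, because removing the lone point
  leaves a chain. The side \<open>B\<close> of the box meets two demands. Translating the box by a
  small point disturbs O(\<open>B\<close> N) relevant points of size \<open>B\<close>, an error of
  order N / \<open>B\<close>, which asks for \<open>B\<close> >= N^3. The tail beyond the box is
  estimated in the coordinates (height, first coordinate), whose distortion costs a power of N that
  \<open>B\<close> must also beat.\<close>

definition tuples :: "'i set \<Rightarrow> 'a::zero set \<Rightarrow> ('i \<Rightarrow> 'a) set" where
  "tuples I Q = {P. (\<forall>i\<in>I. P i \<in> Q) \<and> (\<forall>i. i \<notin> I \<longrightarrow> P i = 0)}"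

lemma tuples_empty [simp]: "tuples {} Q = {\<lambda>_. 0}"
  by (auto simp: tuples_def)

lemma tuples_insert:
  assumes "j \<notin> J"
  shows "tuples (insert j J) Q = (\<lambda>(P, x). P(j := x)) ` (tuples J Q \<times> Q)"
proof (intro equalityI subsetI)
  fix P assume P: "P \<in> tuples (insert j J) Q"
  have "P = (\<lambda>(P, x). P(j := x)) (P(j := 0), P j)" by auto
  moreover have "(P(j := 0), P j) \<in> tuples J Q \<times> Q"
    using P assms by (auto simp: tuples_def)
  ultimately show "P \<in> (\<lambda>(P, x). P(j := x)) ` (tuples J Q \<times> Q)" by (rule image_eqI)
qed (use assms in \<open>auto simp: tuples_def\<close>)

text \<open>Fixing the value 0 off the index set makes a tuple one definite function, so a
  coordinate can be split off at any index and not only at an end, as with lists.\<close>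

lemma inj_on_tuples_update:
  assumes "j \<notin> J"
  shows "inj_on (\<lambda>(P, x). P(j := x)) (tuples J Q \<times> Q)"
proof (rule inj_onI, clarify)
  fix P x P' x' assume a: "P \<in> tuples J Q" "P' \<in> tuples J Q" "P(j := x) = P'(j := x')"
  have "P i = P' i" for i
    using a assms by (cases "i = j") (auto simp: tuples_def dest: fun_cong[of _ _ i])
  moreover have "x = x'" using fun_cong[OF a(3), of j] by simp
  ultimately show "P = P' \<and> x = x'" by auto
qed

lemma finite_tuples:
  assumes "finite I" "finite Q"
  shows "finite (tuples I Q)"
  using assms by (induction I) (auto simp: tuples_insert)

lemma sum_tuples_insert:
  assumes "j \<notin> J"
  shows "(\<Sum>P\<in>tuples (insert j J) Q. G P) = (\<Sum>P\<in>tuples J Q. \<Sum>x\<in>Q. G (P(j := x)))"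
  unfolding tuples_insert[OF assms] sum.reindex[OF inj_on_tuples_update[OF assms]] sum.cartesian_product
  by (simp add: case_prod_beta o_def)

lemma prod_update_insert:
  fixes u :: "'i \<Rightarrow> 'a \<Rightarrow> 'b::comm_monoid_mult"
  assumes "j \<notin> J" "finite J"
  shows "(\<Prod>i\<in>insert j J. u i ((P(j := x)) i)) = u j x * (\<Prod>i\<in>J. u i (P i))"
proof -
  have "(\<Prod>i\<in>J. u i ((P(j := x)) i)) = (\<Prod>i\<in>J. u i (P i))"
    using assms by (intro prod.cong) auto
  then show ?thesis using assms by simp
qed

lemma sum_tuples_prod:
  fixes u :: "'i \<Rightarrow> 'a::zero \<Rightarrow> 'b::comm_semiring_1"
  assumes "finite I"
  shows "(\<Sum>P\<in>tuples I Q. \<Prod>i\<in>I. u i (P i)) = (\<Prod>i\<in>I. \<Sum>x\<in>Q. u i x)"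
  using assms
proof (induction I)
  case (insert j J)
  then show ?case
    by (simp add: sum_tuples_insert prod_update_insert sum_distrib_left sum_distrib_right
             del: prod.insert fun_upd_apply) (simp add: sum_distrib_left [symmetric] insert sum_distrib_right[symmetric])
qed auto

text \<open>The workhorse for iterated sums: summing out coordinate \<open>j\<close> turns the
  condition \<open>c\<close> into a constant \<open>K\<close> and leaves a factor \<open>c'\<close>
  on the other coordinates, ready for the next peel. The order of peeling decides which coordinate
  pays for what.\<close>

lemma sum_tuples_peel:
  fixes u :: "'i \<Rightarrow> 'a::zero \<Rightarrow> real"
  assumes "j \<notin> J" "finite J" "\<And>i x. u i x \<ge> 0"
    and "\<And>P. P \<in> tuples J Q \<Longrightarrow> (\<Sum>x\<in>Q. u j x * c (P(j := x))) \<le> K * c' P"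
  shows "(\<Sum>P\<in>tuples (insert j J) Q. (\<Prod>i\<in>insert j J. u i (P i)) * c P)
           \<le> K * (\<Sum>P\<in>tuples J Q. (\<Prod>i\<in>J. u i (P i)) * c' P)"
proof -
  have "(\<Sum>P\<in>tuples (insert j J) Q. (\<Prod>i\<in>insert j J. u i (P i)) * c P)
      = (\<Sum>P\<in>tuples J Q. (\<Prod>i\<in>J. u i (P i)) * (\<Sum>x\<in>Q. u j x * c (P(j := x))))"
    using assms(1,2)
    by (simp add: sum_tuples_insert prod_update_insert sum_distrib_left mult_ac
             del: prod.insert fun_upd_apply)
  also have "\<dots> \<le> (\<Sum>P\<in>tuples J Q. (\<Prod>i\<in>J. u i (P i)) * (K * c' P))"
    by (intro sum_mono mult_left_mono assms(4) prod_nonneg) (auto simp: assms(3))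
  finally show ?thesis by (simp add: sum_distrib_left mult_ac)
qed

section \<open>Weights of lattice points in a box\<close>

text \<open>A pair \<open>(a, b)\<close> of integers stands for the lattice point \<open>a \<tau> + b\<close>.\<close>

definition mx :: "int \<Rightarrow> real" where "mx m = max 1 \<bar>real_of_int m\<bar>"
definition wt :: "int \<times> int \<Rightarrow> real" where "wt p = max (mx (fst p)) (mx (snd p))"
definition int_box :: "int \<Rightarrow> (int \<times> int) set" where "int_box B = {-B..B} \<times> {-B..B}"
text \<open>A harmonic sum, of size log \<open>B\<close>. The doubled range accommodates differences
  of coordinates of two box points.\<close>

definition hs :: "int \<Rightarrow> real" where "hs B = (\<Sum>m\<in>{-2*B..2*B}. 1 / mx m)"

lemma mx_ge [simp]: "mx m \<ge> 1" "mx m \<ge> \<bar>real_of_int m\<bar>" "0 < mx m" "mx m \<noteq> 0" "0 \<le> mx m"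
  by (auto simp: mx_def)

lemma mx_nz: "m \<noteq> 0 \<Longrightarrow> mx m = \<bar>real_of_int m\<bar>"
  by (auto simp: mx_def)

lemma mx_minus [simp]: "mx (- m) = mx m" by (simp add: mx_def)

lemma wt_ge [simp]: "wt p \<ge> 1" "wt p \<ge> mx (fst p)" "wt p \<ge> mx (snd p)" "0 < wt p" "wt p \<noteq> 0" "0 \<le> wt p"
proof -
  show "wt p \<ge> 1" "wt p \<ge> mx (fst p)" "wt p \<ge> mx (snd p)"
    using mx_ge(1)[of "fst p"] unfolding wt_def by linarith+
  then show "0 < wt p" "wt p \<noteq> 0" "0 \<le> wt p" by linarith+
qed

lemma abs_le_wt: "\<bar>real_of_int (fst x)\<bar> \<le> wt x" "\<bar>real_of_int (snd x)\<bar> \<le> wt x"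
  using mx_ge(2)[of "fst x"] mx_ge(2)[of "snd x"] wt_ge(2,3)[of x] by linarith+

lemma wt_minus [simp]: "wt (- p) = wt p" by (simp add: wt_def)
lemma wt_0 [simp]: "wt 0 = 1" by (simp add: wt_def mx_def)

lemma finite_box [simp]: "finite (int_box B)" by (simp add: int_box_def)

lemma zero_in_box: "B \<ge> 0 \<Longrightarrow> 0 \<in> int_box B" by (simp add: int_box_def zero_prod_def)

lemma hs_ge_1: "B \<ge> 0 \<Longrightarrow> hs B \<ge> 1"
proof -
  assume "B \<ge> 0"
  then have "(\<Sum>m\<in>{0}. 1 / mx m) \<le> hs B" unfolding hs_def by (intro sum_mono2) auto
  then show ?thesis by (simp add: mx_def)
qed

lemma sum_mx_le: "finite M \<Longrightarrow> inj_on f M \<Longrightarrow> f ` M \<subseteq> {-2*B..2*B} \<Longrightarrow> (\<Sum>m\<in>M. 1 / mx (f m)) \<le> hs B"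
proof -
  assume "finite M" "inj_on f M" "f ` M \<subseteq> {-2*B..2*B}"
  then have "(\<Sum>m\<in>f ` M. 1 / mx m) \<le> hs B" unfolding hs_def by (intro sum_mono2) auto
  then show ?thesis using \<open>inj_on f M\<close> by (simp add: sum.reindex)
qed

lemma sum_box_le:
  fixes f :: "int \<times> int \<Rightarrow> real"
  assumes "\<And>a b. a \<in> {-B..B} \<Longrightarrow> b \<in> {-B..B} \<Longrightarrow> f (a, b) \<le> k * (g a * g' b)"
    and "(\<Sum>a\<in>{-B..B}. g a) \<le> G" "(\<Sum>b\<in>{-B..B}. g' b) \<le> G'" "\<And>a. g a \<ge> 0" "\<And>b. g' b \<ge> 0" "k \<ge> 0"
  shows "(\<Sum>x\<in>int_box B. f x) \<le> k * (G * G')"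
proof -
  have "(\<Sum>x\<in>int_box B. f x) \<le> (\<Sum>x\<in>int_box B. k * (g (fst x) * g' (snd x)))"
    using assms(1) by (intro sum_mono) (auto simp: int_box_def)
  also have "\<dots> = k * ((\<Sum>a\<in>{-B..B}. g a) * (\<Sum>b\<in>{-B..B}. g' b))"
    unfolding int_box_def sum_product sum.cartesian_product by (simp add: sum_distrib_left case_prod_beta)
  also have "\<dots> \<le> k * (G * G')"
    by (intro mult_left_mono mult_mono assms sum_nonneg order.trans[OF _ assms(2)])
  finally show ?thesis .
qed

text \<open>
  Positive cones of the two orders: \<open>\<lambda> \<succ> \<mu>\<close> iff \<open>\<lambda> - \<mu>\<close> lies in the cone. They differ only on \<open>wedge N\<close>.
\<close>

definition pos0 :: "int \<times> int \<Rightarrow> bool" where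
  "pos0 d \<longleftrightarrow> fst d > 0 \<or> (fst d = 0 \<and> snd d > 0)"

definition posN :: "nat \<Rightarrow> int \<times> int \<Rightarrow> bool" where
  "posN N d \<longleftrightarrow> height N (fst d) (snd d) > 0 \<or> (height N (fst d) (snd d) = 0 \<and> fst d < 0)"

definition wedge :: "nat \<Rightarrow> int \<times> int \<Rightarrow> bool" where
  "wedge N d \<longleftrightarrow> fst d \<noteq> 0 \<and> int N * \<bar>fst d\<bar> \<le> \<bar>snd d\<bar>"

text \<open>The wedge condition on \<open>x - q\<close> with the large second coordinate attributed
  to \<open>x\<close> alone; the factor 2 leaves room for the share of \<open>q\<close>.\<close>

definition steep_at :: "nat \<Rightarrow> int \<times> int \<Rightarrow> int \<times> int \<Rightarrow> bool" where
  "steep_at N x q \<longleftrightarrow> fst x \<noteq> fst q \<and> int N * \<bar>fst x - fst q\<bar> \<le> 2 * \<bar>snd x\<bar>"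

text \<open>The threshold N/4 is low enough that both orders agree on two small points, and that
  translation by a small point changes a weight of at least N by less than a factor 2.\<close>

definition small :: "nat \<Rightarrow> int \<times> int \<Rightarrow> bool" where
  "small N p \<longleftrightarrow> 4 * \<bar>fst p\<bar> < int N \<and> 4 * \<bar>snd p\<bar> < int N"

lemma pos0_total: "d \<noteq> 0 \<Longrightarrow> pos0 (- d) \<longleftrightarrow> \<not> pos0 d"
  by (cases d) (auto simp: pos0_def zero_prod_def)

lemma posN_total: "d \<noteq> 0 \<Longrightarrow> posN N (- d) \<longleftrightarrow> \<not> posN N d"
  by (cases d; cases "fst d = 0") (auto simp: posN_def height_def zero_prod_def)

lemma not_pos_0 [simp]: "\<not> pos0 0" "\<not> posN N 0"
  by (auto simp: pos0_def posN_def height_def)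

lemma pos0_add: "pos0 d \<Longrightarrow> pos0 e \<Longrightarrow> pos0 (d + e)"
  by (auto simp: pos0_def)

lemma posN_add: "posN N d \<Longrightarrow> posN N e \<Longrightarrow> posN N (d + e)"
  by (auto simp: posN_def height_def distrib_left)

lemma pos_eq_or_wedge: "posN N d = pos0 d \<or> wedge N d"
proof -
  consider "fst d = 0" | "fst d > 0" | "fst d < 0" by linarith
  then show ?thesis
    by cases (auto simp: posN_def pos0_def wedge_def height_def)
qed

lemma wedge_minus [simp]: "wedge N (- d) = wedge N d"
  by (simp add: wedge_def)

lemma small_0 [simp]: "N \<ge> 1 \<Longrightarrow> small N 0" by (simp add: small_def)

text \<open>The second coordinates differ by at least N times the difference of the first ones,
  hence by at least N; a small \<open>q\<close> contributes less than a quarter of this, so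
  \<open>x\<close> supplies more than half.\<close>

lemma wedge_steep_at:
  assumes "N \<ge> 1" "wedge N (x - q)" "small N q"
  shows "steep_at N x q"
proof -
  have "int N \<le> int N * \<bar>fst x - fst q\<bar>"
    using assms mult_left_mono[of 1 "\<bar>fst x - fst q\<bar>" "int N"] by (auto simp: wedge_def)
  moreover have "int N * \<bar>fst x - fst q\<bar> \<le> \<bar>snd x - snd q\<bar>" "4 * \<bar>snd q\<bar> < int N" "fst x \<noteq> fst q"
    using assms by (auto simp: wedge_def small_def)
  ultimately show ?thesis unfolding steep_at_def by linarith
qed

text \<open>One of two numbers has at least half the absolute value of their difference.\<close>

lemma wedge_steep_at_either:
  assumes "wedge N (x - q)"
  shows "steep_at N x q \<or> steep_at N q x"
  using assms by (auto simp: wedge_def steep_at_def abs_minus_commute)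

lemma steep_at_not_small:
  assumes "N \<ge> 1" "steep_at N x q"
  shows "\<not> small N x"
proof -
  have "int N \<le> int N * \<bar>fst x - fst q\<bar>"
    using assms mult_left_mono[of 1 "\<bar>fst x - fst q\<bar>" "int N"] by (auto simp: steep_at_def)
  then show ?thesis using assms unfolding steep_at_def small_def by linarith
qed

text \<open>The difference of the first coordinates is kept instead of being bounded below by 1:
  besides the gain of N it leaves a harmonic factor for the summation over
  \<open>fst x\<close>.\<close>

lemma steep_at_bounds:
  assumes "N \<ge> 1" "steep_at N x q"
  shows "real N / 2 * mx (fst x - fst q) \<le> wt x"
proof -
  have "real_of_int (int N * \<bar>fst x - fst q\<bar>) \<le> real_of_int (2 * \<bar>snd x\<bar>)"
    using assms unfolding steep_at_def by linarith
  moreover note abs_le_wt(2)[of x]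
  ultimately show ?thesis using assms by (simp add: mx_nz steep_at_def)
qed

lemma wedge_bounds:
  assumes "N \<ge> 1" "wedge N d"
  shows "real N * mx (fst d) \<le> wt d"
proof -
  have "real_of_int (int N * \<bar>fst d\<bar>) \<le> real_of_int \<bar>snd d\<bar>"
    using assms unfolding wedge_def by linarith
  moreover note abs_le_wt(2)[of d]
  ultimately show ?thesis using assms by (simp add: mx_nz wedge_def)
qed

lemma not_small_bound: "\<not> small N x \<Longrightarrow> real N / 4 \<le> wt x"
proof -
  assume "\<not> small N x"
  then consider "real N \<le> 4 * \<bar>real_of_int (fst x)\<bar>" | "real N \<le> 4 * \<bar>real_of_int (snd x)\<bar>"
    unfolding small_def by linarith
  then show ?thesis
    using mx_ge(2)[of "fst x"] mx_ge(2)[of "snd x"] wt_ge(2)[of x] wt_ge(3)[of x] by cases linarith+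
qed

section \<open>Logarithmic sums of weights over a box\<close>

lemma inverse_sq_le:
  fixes s t w :: real
  assumes "0 < s" "s \<le> w" "0 < t" "t \<le> w"
  shows "1 / w^2 \<le> (1 / s) * (1 / t)"
proof -
  have "s * t \<le> w * w" using assms by (intro mult_mono) auto
  then show ?thesis using assms by (simp add: power2_eq_square frac_le)
qed

lemma inverse_cube_le:
  fixes s t w :: real
  assumes "0 < s" "s \<le> w" "0 < t" "t \<le> w" "0 < u" "u \<le> w"
  shows "1 / w^3 \<le> (1 / u) * ((1 / s) * (1 / t))"
proof -
  have "u * (s * t) \<le> w * (w * w)" using assms by (intro mult_mono) auto
  then show ?thesis using assms by (simp add: power3_eq_cube frac_le mult_ac)
qed

text \<open>What a \<open>pos0\<close> chain from \<open>q\<close> down to 0 imposes on the first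
  coordinates of its members.\<close>

definition strip :: "int \<times> int \<Rightarrow> int \<times> int \<Rightarrow> bool" where
  "strip q x \<longleftrightarrow> 0 \<le> fst x \<and> fst x \<le> fst q"

lemma hs_nonneg [simp]: "0 \<le> hs B" by (simp add: hs_def sum_nonneg)

context
  fixes B :: int
  assumes B: "B \<ge> 0"
begin

lemma sum_mx_shift: "q \<in> int_box B \<Longrightarrow> (\<Sum>a\<in>{-B..B}. 1 / mx (a - fst q)) \<le> hs B"
  by (intro sum_mx_le) (auto simp: inj_on_def int_box_def)

lemma sum_mx: "(\<Sum>a\<in>{-B..B}. 1 / mx a) \<le> hs B"
  using B sum_mx_le[of "{-B..B}" "\<lambda>a. a" B] by (auto simp: inj_on_def)

lemma sum_wt2: "(\<Sum>x\<in>int_box B. 1 / wt x ^ 2) \<le> hs B ^ 2"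
proof -
  have "(\<Sum>x\<in>int_box B. 1 / wt x ^ 2) \<le> 1 * (hs B * hs B)"
  proof (rule sum_box_le[where g = "\<lambda>a. 1 / mx a" and g' = "\<lambda>a. 1 / mx a"])
    fix a b show "1 / wt (a, b) ^ 2 \<le> 1 * (1 / mx a * (1 / mx b))"
      using inverse_sq_le[of "mx a" "wt (a,b)" "mx b"] wt_ge[of "(a,b)"] by simp
  qed (auto simp: sum_mx)
  then show ?thesis by (simp add: power2_eq_square)
qed

lemma sum_strip_indicator:
  assumes "q \<in> int_box B"
  shows "(\<Sum>a\<in>{-B..B}. of_bool (0 \<le> a \<and> a \<le> fst q)) \<le> 2 * mx (fst q)"
proof -
  have "(\<Sum>a\<in>{-B..B}. of_bool (0 \<le> a \<and> a \<le> fst q) :: real) = real (card ({-B..B} \<inter> {a. 0 \<le> a \<and> a \<le> fst q}))"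
    by (simp add: of_bool_def sum.If_cases)
  also have "\<dots> \<le> real (card {0..fst q})"
    by (intro of_nat_mono card_mono) auto
  also have "\<dots> \<le> 2 * mx (fst q)" by (simp add: mx_def)
  finally show ?thesis .
qed

text \<open>A strip contains O(\<open>mx (fst q)\<close>) first coordinates, and for each of them
  the sum of 1 / \<open>wt\<close> over the second coordinate is harmonic. So inside a strip one
  power of the weight may be given away.\<close>

lemma sum_strip_wt:
  assumes "q \<in> int_box B"
  shows "(\<Sum>x\<in>int_box B. 1 / wt x ^ 2 * (wt x * of_bool (strip q x))) \<le> 2 * hs B * mx (fst q)"
proof -
  have "(\<Sum>x\<in>int_box B. 1 / wt x ^ 2 * (wt x * of_bool (strip q x))) \<le> 1 * ((2 * mx (fst q)) * hs B)"
  proof (rule sum_box_le[where g = "\<lambda>a. of_bool (0 \<le> a \<and> a \<le> fst q)" and g' = "\<lambda>a. 1 / mx a"])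
    fix a b 
    have "1 / wt (a,b) \<le> 1 / mx b" using wt_ge[of "(a,b)"] by (intro frac_le) auto
    then show "1 / wt (a,b) ^ 2 * (wt (a,b) * of_bool (strip q (a,b))) \<le> 1 * (of_bool (0 \<le> a \<and> a \<le> fst q) * (1 / mx b))"
      by (auto simp: strip_def power2_eq_square)
  qed (use assms in \<open>auto simp: sum_mx sum_strip_indicator simp del: sum_of_bool_eq\<close>)
  then show ?thesis by (simp add: mult_ac)
qed

text \<open>Here the third power in the weight of the first member pays for the width of the strip
  below it.\<close>

lemma sum_wt3_mx: "(\<Sum>x\<in>int_box B. 1 / wt x ^ 3 * mx (fst x)) \<le> hs B ^ 2"
proof -
  have "1 / wt x ^ 3 * mx (fst x) \<le> 1 / wt x ^ 2" for x
    using wt_ge[of x] by (simp add: field_simps power2_eq_square power3_eq_cube)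
  then have "(\<Sum>x\<in>int_box B. 1 / wt x ^ 3 * mx (fst x)) \<le> (\<Sum>x\<in>int_box B. 1 / wt x ^ 2)" by (intro sum_mono)
  then show ?thesis using sum_wt2 by linarith
qed

lemma sum_wt3_wt: "(\<Sum>x\<in>int_box B. 1 / wt x ^ 3 * wt x) \<le> hs B ^ 2"
proof -
  have "1 / wt x ^ 3 * wt x \<le> 1 / wt x ^ 2" for x
    using wt_ge[of x] by (simp add: field_simps power2_eq_square power3_eq_cube)
  then have "(\<Sum>x\<in>int_box B. 1 / wt x ^ 3 * wt x) \<le> (\<Sum>x\<in>int_box B. 1 / wt x ^ 2)" by (intro sum_mono)
  then show ?thesis using sum_wt2 by linarith
qed

lemma sum_wt3: "(\<Sum>x\<in>int_box B. 1 / wt x ^ 3) \<le> hs B ^ 2"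
proof -
  have "1 / wt x ^ 3 \<le> 1 / wt x ^ 2" for x
    using wt_ge[of x] by (intro frac_le power_increasing) auto
  then have "(\<Sum>x\<in>int_box B. 1 / wt x ^ 3) \<le> (\<Sum>x\<in>int_box B. 1 / wt x ^ 2)" by (intro sum_mono)
  then show ?thesis using sum_wt2 by linarith
qed

end

context
  fixes N :: nat and B :: int
  assumes N: "N \<ge> 1" and B: "B \<ge> 0"
begin

text \<open>One power of the weight is spent on steepness, giving 1/N and a harmonic sum centred at
  \<open>fst q\<close>; the other gives a harmonic sum over the second coordinate. The bound is
  uniform in \<open>q\<close>.\<close>

lemma sum_steep_at:
  assumes "q \<in> int_box B"
  shows "(\<Sum>x\<in>int_box B. 1 / wt x ^ 2 * of_bool (steep_at N x q)) \<le> 2 * hs B ^ 2 / N"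
proof -
  have "(\<Sum>x\<in>int_box B. 1 / wt x ^ 2 * of_bool (steep_at N x q)) \<le> (2 / N) * (hs B * hs B)"
  proof (rule sum_box_le[where g = "\<lambda>a. 1 / mx (a - fst q)" and g' = "\<lambda>a. 1 / mx a"])
    fix a b show "1 / wt (a, b) ^ 2 * of_bool (steep_at N (a,b) q) \<le> (2 / N) * (1 / mx (a - fst q) * (1 / mx b))"
    proof (cases "steep_at N (a,b) q")
      case True
      then show ?thesis
        using inverse_sq_le[of "real N / 2 * mx (a - fst q)" "wt (a,b)" "mx b"] wt_ge[of "(a,b)"]
          steep_at_bounds[OF N True] N by simp
    qed auto
  qed (use assms in \<open>auto simp: sum_mx[OF B] sum_mx_shift[OF B]\<close>)
  then show ?thesis by (simp add: power2_eq_square)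
qed

text \<open>As for exponent 2, with the additional power bounded by 2/N, since a steep point has
  weight at least N/2.\<close>

lemma sum_steep_at_cube:
  assumes "q \<in> int_box B"
  shows "(\<Sum>x\<in>int_box B. 1 / wt x ^ 3 * of_bool (steep_at N x q)) \<le> 4 * hs B ^ 2 / N^2"
proof -
  have "(\<Sum>x\<in>int_box B. 1 / wt x ^ 3 * of_bool (steep_at N x q)) \<le> (4 / N^2) * (hs B * hs B)"
  proof (rule sum_box_le[where g = "\<lambda>a. 1 / mx (a - fst q)" and g' = "\<lambda>a. 1 / mx a"])
    fix a b show "1 / wt (a, b) ^ 3 * of_bool (steep_at N (a,b) q) \<le> (4 / N^2) * (1 / mx (a - fst q) * (1 / mx b))"
    proof (cases "steep_at N (a,b) q")
      case True
      have "real N / 2 * 1 \<le> real N / 2 * mx (a - fst q)" by (intro mult_left_mono) auto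
      then have "real N / 2 \<le> wt (a, b)"
        using steep_at_bounds[OF N True] by simp
      then show ?thesis
        using inverse_cube_le[of "real N / 2 * mx (a - fst q)" "wt (a,b)" "mx b" "real N / 2"] wt_ge[of "(a,b)"]
          steep_at_bounds[OF N True] N by (simp add: power2_eq_square)
    qed auto
  qed (use assms in \<open>auto simp: sum_mx[OF B] sum_mx_shift[OF B]\<close>)
  then show ?thesis by (simp add: power2_eq_square)
qed

lemma sum_wedge_cube: "(\<Sum>x\<in>int_box B. 1 / wt x ^ 3 * of_bool (wedge N x)) \<le> hs B ^ 2 / N^2"
proof -
  have "(\<Sum>x\<in>int_box B. 1 / wt x ^ 3 * of_bool (wedge N x)) \<le> (1 / N^2) * (hs B * hs B)"
  proof (rule sum_box_le[where g = "\<lambda>a. 1 / mx a" and g' = "\<lambda>a. 1 / mx a"])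
    fix a b show "1 / wt (a, b) ^ 3 * of_bool (wedge N (a,b)) \<le> (1 / N^2) * (1 / mx a * (1 / mx b))"
    proof (cases "wedge N (a,b)")
      case True
      have "real N * 1 \<le> real N * mx a" by (intro mult_left_mono) auto
      then have "real N \<le> wt (a, b)"
        using wedge_bounds[OF N True] by simp
      then show ?thesis
        using inverse_cube_le[of "real N * mx a" "wt (a,b)" "mx b" "real N"] wt_ge[of "(a,b)"]
          wedge_bounds[OF N True] N True by (simp add: power2_eq_square)
    qed auto
  qed (auto simp: sum_mx[OF B])
  then show ?thesis by (simp add: power2_eq_square)
qed

lemma sum_not_small_cube: "(\<Sum>x\<in>int_box B. 1 / wt x ^ 3 * of_bool (\<not> small N x)) \<le> 4 * hs B ^ 2 / N"
proof -
  have "(\<Sum>x\<in>int_box B. 1 / wt x ^ 3 * of_bool (\<not> small N x)) \<le> (4 / N) * (hs B * hs B)"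
  proof (rule sum_box_le[where g = "\<lambda>a. 1 / mx a" and g' = "\<lambda>a. 1 / mx a"])
    fix a b show "1 / wt (a, b) ^ 3 * of_bool (\<not> small N (a,b)) \<le> (4 / N) * (1 / mx a * (1 / mx b))"
    proof (cases "small N (a,b)")
      case False
      then show ?thesis
        using inverse_cube_le[of "mx a" "wt (a,b)" "mx b" "real N / 4"] wt_ge[of "(a,b)"]
          not_small_bound[OF False] N by simp
    qed auto
  qed (auto simp: sum_mx[OF B])
  then show ?thesis by (simp add: power2_eq_square)
qed

lemma sum_strip_not_small:
  assumes "q \<in> int_box B" "small N q"
  shows "(\<Sum>x\<in>int_box B. 1 / wt x ^ 2 * of_bool (\<not> small N x \<and> strip q x)) \<le> 8 * hs B * mx (fst q) / N"
proof -
  have "(\<Sum>x\<in>int_box B. 1 / wt x ^ 2 * of_bool (\<not> small N x \<and> strip q x)) \<le> (4 / N) * ((2 * mx (fst q)) * hs B)"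
  proof (rule sum_box_le[where g = "\<lambda>a. of_bool (0 \<le> a \<and> a \<le> fst q)" and g' = "\<lambda>a. 1 / mx a"])
    fix a b 
    show "1 / wt (a,b) ^ 2 * of_bool (\<not> small N (a,b) \<and> strip q (a,b)) \<le> (4/N) * (of_bool (0 \<le> a \<and> a \<le> fst q) * (1 / mx b))"
    proof (cases "\<not> small N (a,b) \<and> strip q (a,b)")
      case True
      then show ?thesis
        using inverse_sq_le[of "mx b" "wt (a,b)" "real N / 4"] wt_ge[of "(a,b)"]
          not_small_bound[of N "(a,b)"] N by (simp add: strip_def mult.commute)
    qed auto
  qed (use assms in \<open>auto simp: sum_mx[OF B] sum_strip_indicator[OF B] simp del: sum_of_bool_eq\<close>)
  then show ?thesis by (simp add: mult_ac)
qed

text \<open>A large \<open>x\<close> in the strip gives the coefficient 8, and each of the two wedge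
  conditions, rewritten as steepness against 0 or against \<open>q\<close>, gives 2. The smallness
  of \<open>q\<close> is what permits the second rewriting.\<close>

lemma sum_far:
  assumes "q \<in> int_box B"
  shows "(\<Sum>x\<in>int_box B. 1 / wt x ^ 2 * of_bool (small N q \<and> \<not> small N x \<and> (strip q x \<or> wedge N x \<or> wedge N (x - q))))
     \<le> (12 * hs B ^ 2 / N) * mx (fst q)"
proof (cases "small N q")
  case True
  have "(\<Sum>x\<in>int_box B. 1 / wt x ^ 2 * of_bool (small N q \<and> \<not> small N x \<and> (strip q x \<or> wedge N x \<or> wedge N (x - q))))
    \<le> (\<Sum>x\<in>int_box B. 1 / wt x ^ 2 * of_bool (\<not> small N x \<and> strip q x) + (1 / wt x ^ 2 * of_bool (steep_at N x 0)
         + 1 / wt x ^ 2 * of_bool (steep_at N x q)))"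
    using wedge_steep_at[OF N _ True] wedge_steep_at[OF N, of _ 0] N by (intro sum_mono) auto
  also have "\<dots> \<le> 8 * hs B * mx (fst q) / N + (2 * hs B ^ 2 / N + 2 * hs B ^ 2 / N)"
    unfolding sum.distrib using True assms B
    by (intro add_mono sum_strip_not_small sum_steep_at) (auto simp: zero_in_box)
  also have "\<dots> \<le> 8 * hs B ^ 2 * mx (fst q) / N + (2 * hs B ^ 2 * mx (fst q) / N + 2 * hs B ^ 2 * mx (fst q) / N)"
  proof -
    have "hs B * 1 \<le> hs B * hs B" using hs_ge_1[OF B] by (intro mult_left_mono) auto
    then have 1: "8 * hs B * mx (fst q) \<le> 8 * hs B ^ 2 * mx (fst q)"
      by (intro mult_right_mono) (auto simp: power2_eq_square)
    have 2: "2 * hs B ^ 2 * 1 \<le> 2 * hs B ^ 2 * mx (fst q)" by (intro mult_left_mono) auto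
    show ?thesis using 1 2 by (intro add_mono divide_right_mono) auto
  qed
  finally show ?thesis by (simp add: field_simps)
qed auto

end

section \<open>Chains on which the two orders disagree\<close>

text \<open>
  The paper's \<open>\<lambda>\<^sub>i\<close> is \<open>P (i - 1)\<close>; a tuple over \<open>{..<r}\<close> has \<open>P r = 0\<close>, which closes the chain with
  \<open>\<lambda>\<^sub>r \<succ> 0\<close>.
\<close>

definition cone_chain :: "('a::group_add \<Rightarrow> bool) \<Rightarrow> nat \<Rightarrow> (nat \<Rightarrow> 'a) \<Rightarrow> bool" where
  "cone_chain R r P \<longleftrightarrow> (\<forall>i<r. R (P i - P (Suc i)))"

lemma chain_less:
  assumes add: "\<And>d e. R d \<Longrightarrow> R e \<Longrightarrow> R (d + e)" and "cone_chain R r P" "i < j" "j \<le> r"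
  shows "R (P i - P j)"
  using \<open>i < j\<close> \<open>j \<le> r\<close>
proof (induction j)
  case (Suc j)
  have step: "R (P j - P (Suc j))" using assms(2) Suc.prems by (simp add: cone_chain_def)
  show ?case
  proof (cases "i = j")
    case False
    then have "R ((P i - P j) + (P j - P (Suc j)))" using Suc step by (intro add) auto
    then show ?thesis unfolding add_diff_eq diff_add_cancel .
  qed (use step in simp)
qed simp

lemma chain_strip:
  assumes "cone_chain pos0 r P" "P r = 0" "i < r"
  shows "strip (P 0) (P i)"
proof -
  have "pos0 (P i - P r)" using assms by (intro chain_less[of pos0 r P] pos0_add) auto
  moreover have "i = 0 \<or> pos0 (P 0 - P i)"
    using chain_less[of pos0 r P 0 i] pos0_add assms by auto
  ultimately show ?thesis using assms by (auto simp: strip_def pos0_def)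
qed

lemma wedge_commute: "wedge N (x - y) = wedge N (y - x)"
  using wedge_minus[of N "x - y"] by (simp del: wedge_minus)

text \<open>By transitivity each member is comparable with both ends \<open>P 0\<close> and
  \<open>P r = 0\<close> of the chain. For an N-chain each of these two comparisons either holds for
  \<open>pos0\<close> as well or falls into a wedge, so one condition serves both orders.\<close>

lemma chain_strip_or_wedge:
  assumes "cone_chain pos0 r P \<or> cone_chain (posN N) r P" "P r = 0" "0 < i" "i < r"
  shows "strip (P 0) (P i) \<or> wedge N (P i) \<or> wedge N (P i - P 0)"
proof (cases "cone_chain pos0 r P")
  case True
  then show ?thesis using chain_strip assms by blast
next
  case False
  then have c: "cone_chain (posN N) r P" using assms by blast
  have "posN N (P i - P r)" "posN N (P 0 - P i)"
    using assms by (intro chain_less[of "posN N" r P] posN_add c; simp)+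
  then show ?thesis using assms pos_eq_or_wedge[of N "P i"] pos_eq_or_wedge[of N "P 0 - P i"]
    by (auto simp: strip_def pos0_def wedge_commute)
qed

text \<open>The weakest decay that the hypotheses on the exponents guarantee, with the spare power
  at index 0.\<close>

definition uw :: "nat \<Rightarrow> int \<times> int \<Rightarrow> real" where
  "uw i x = (if i = 0 then 1 / wt x ^ 3 else 1 / wt x ^ 2)"

lemma uw_nonneg [simp]: "uw i x \<ge> 0" by (simp add: uw_def)

definition far :: "nat \<Rightarrow> int \<times> int \<Rightarrow> int \<times> int \<Rightarrow> bool" where
  "far N q x \<longleftrightarrow> small N q \<and> \<not> small N x \<and> (strip q x \<or> wedge N x \<or> wedge N (x - q))"

text \<open>The three configurations for which absolute values yield 1/N twice: a steep first
  member, whose exponent is 3; a steep later member with a large first one; a steep later member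
  with another one that is large and confined. The index \<open>l\<close> may be \<open>r\<close>,
  that is, steepness against the final 0 is included.\<close>

definition bad :: "nat \<Rightarrow> nat \<Rightarrow> (nat \<Rightarrow> int \<times> int) \<Rightarrow> bool" where
  "bad N r P \<longleftrightarrow> steep_at N (P 0) (P 1) \<or>
     (\<exists>j\<in>{1..<r}. \<exists>l\<in>{..r} - {j}. steep_at N (P j) (P l) \<and> \<not> small N (P 0)) \<or>
     (\<exists>j\<in>{1..<r}. \<exists>l\<in>{..r} - {j}. \<exists>i\<in>{1..<r} - {j}. steep_at N (P j) (P l) \<and> far N (P 0) (P i))"

definition lone :: "nat \<Rightarrow> nat \<Rightarrow> nat \<Rightarrow> (nat \<Rightarrow> int \<times> int) \<Rightarrow> bool" where
  "lone N r j P \<longleftrightarrow> \<not> small N (P j) \<and> (\<forall>i\<in>{..<r} - {j}. small N (P i))"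

text \<open>A disagreement occurs between two neighbours, one of which is then steep against the
  other and so large. What remains is to ask whether a further member is large.\<close>

lemma discrepancy_cases:
  assumes "N \<ge> 1" "cone_chain pos0 r P \<noteq> cone_chain (posN N) r P" "P r = 0"
  shows "bad N r P \<or> (\<exists>j\<in>{1..<r}. lone N r j P)"
proof -
  have "\<exists>i<r. pos0 (P i - P (Suc i)) \<noteq> posN N (P i - P (Suc i))"
    using assms(2) unfolding cone_chain_def by blast
  then obtain i where i: "i < r" "wedge N (P i - P (Suc i))"
    using pos_eq_or_wedge by blast
  \<comment> \<open>Since 0 is small it is never steep, so the steep neighbour is never the terminal
    entry \<open>P r\<close>.\<close>
  have not0: "\<not> steep_at N 0 q" for q
    using assms(1) steep_at_not_small[of N 0 q] by auto
  \<comment> \<open>If the steep member is \<open>P 0\<close>, its neighbour can only be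
    \<open>P 1\<close>; this is the form that \<open>bad\<close> uses.\<close>
  from wedge_steep_at_either[OF i(2)] have "\<exists>j l. j < r \<and> l \<le> r \<and> l \<noteq> j \<and> (j = 0 \<longrightarrow> l = 1) \<and> steep_at N (P j) (P l)"
  proof
    assume "steep_at N (P i) (P (Suc i))"
    then show ?thesis using i(1) by (intro exI[of _ i] exI[of _ "Suc i"]) auto
  next
    assume u: "steep_at N (P (Suc i)) (P i)"
    then have "Suc i \<noteq> r" using not0[of "P i"] assms(3) by metis
    then show ?thesis using i(1) u by (intro exI[of _ "Suc i"] exI[of _ i]) auto
  qed
  then obtain j l where jl: "j < r" "l \<le> r" "l \<noteq> j" "j = 0 \<longrightarrow> l = 1" "steep_at N (P j) (P l)" by blast
  show ?thesis
  proof (cases "j = 0 \<or> \<not> small N (P 0) \<or> (\<exists>i\<in>{1..<r} - {j}. \<not> small N (P i))")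
    case True
    then consider "j = 0" | "j \<in> {1..<r}" "\<not> small N (P 0)"
      | i where "j \<in> {1..<r}" "small N (P 0)" "i \<in> {1..<r} - {j}" "\<not> small N (P i)"
      using jl(1) by (metis Suc_leI atLeastLessThan_iff neq0_conv One_nat_def)
    then show ?thesis
    proof cases
      case 3
      have "far N (P 0) (P i)"
        using chain_strip_or_wedge[of r P N i] assms 3 by (auto simp: far_def)
      then show ?thesis using jl 3 unfolding bad_def by (auto simp: Bex_def)
    qed (use jl in \<open>auto simp: bad_def\<close>)
  next
    case False
    then have "small N (P i)" if "i < r" "i \<noteq> j" for i
      using that by (cases "i = 0") auto
    then have "lone N r j P"
      using steep_at_not_small[OF assms(1) jl(5)] by (auto simp: lone_def)
    then show ?thesis using False jl by auto
  qed
qed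

section \<open>Tuple sums with a double gain, and the price of a neighbour\<close>

context
  fixes N :: nat and B :: int
  assumes N: "N \<ge> 1" and B: "B \<ge> 0"
begin

lemma tuples_box: "P \<in> tuples J (int_box B) \<Longrightarrow> P i \<in> int_box B"
  using zero_in_box[OF B] by (cases "i \<in> J") (auto simp: tuples_def)

lemma sum_tuples_uw:
  assumes "finite J"
  shows "(\<Sum>P\<in>tuples J (int_box B). \<Prod>i\<in>J. uw i (P i)) \<le> hs B ^ (2 * card J)"
proof -
  have "(\<Sum>P\<in>tuples J (int_box B). \<Prod>i\<in>J. uw i (P i)) = (\<Prod>i\<in>J. \<Sum>x\<in>int_box B. uw i x)"
    by (rule sum_tuples_prod[OF assms])
  also have "\<dots> \<le> (\<Prod>i\<in>J. hs B ^ 2)"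
  proof (intro prod_mono conjI sum_nonneg)
    fix i show "(\<Sum>x\<in>int_box B. uw i x) \<le> hs B ^ 2"
      using sum_wt2[OF B] sum_wt3[OF B] by (cases "i = 0") (auto simp: uw_def)
  qed auto
  finally show ?thesis by (simp add: power_mult)
qed

lemma hs_power_mono: "i \<le> j \<Longrightarrow> hs B ^ i \<le> hs B ^ j"
  using hs_ge_1[OF B] by (intro power_increasing) auto

lemma sum_tuples_steep_at_0:
  assumes "r \<ge> 1"
  shows "(\<Sum>P\<in>tuples {..<r} (int_box B). (\<Prod>i<r. uw i (P i)) * of_bool (steep_at N (P 0) (P 1)))
            \<le> 4 * hs B ^ (2 * r) / N^2"
proof -
  define J where "J = {..<r} - {0}"
  have J: "{..<r} = insert 0 J" "0 \<notin> J" "finite J" "card J = r - 1" using assms by (auto simp: J_def)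
  have "(\<Sum>P\<in>tuples {..<r} (int_box B). (\<Prod>i<r. uw i (P i)) * of_bool (steep_at N (P 0) (P 1)))
     \<le> (4 * hs B ^ 2 / N^2) * (\<Sum>P\<in>tuples J (int_box B). (\<Prod>i\<in>J. uw i (P i)) * 1)"
    unfolding J(1)
    using sum_steep_at_cube[OF N B tuples_box] by (intro sum_tuples_peel J) (auto simp: uw_def)
  also have "\<dots> \<le> (4 * hs B ^ 2 / N^2) * hs B ^ (2 * (r - 1))"
    using sum_tuples_uw[OF J(3)] J(4) by (intro mult_left_mono) auto
  also have "\<dots> = 4 * (hs B ^ 2 * hs B ^ (2 * (r - 1))) / N^2" by simp
  also have "hs B ^ 2 * hs B ^ (2 * (r - 1)) = hs B ^ (2 * r)"
    unfolding power_add [symmetric] using assms by (intro arg_cong[of _ _ "power _"]) simp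
  finally show ?thesis .
qed

text \<open>Index \<open>j\<close> is summed out first, while \<open>P l\<close> is still fixed;
  since the steepness bound is uniform in \<open>P l\<close>, the case \<open>l = 0\<close> needs no
  special care when index 0 is summed next.\<close>

lemma sum_tuples_steep_at_not_small:
  assumes "j \<in> {1..<r}" "l \<noteq> j"
  shows "(\<Sum>P\<in>tuples {..<r} (int_box B). (\<Prod>i<r. uw i (P i)) * of_bool (steep_at N (P j) (P l) \<and> \<not> small N (P 0)))
            \<le> 8 * hs B ^ (2 * r) / N^2"
proof -
  define J where "J = {..<r} - {0, j}"
  have J: "{..<r} = insert j (insert 0 J)" "0 \<notin> J" "j \<notin> insert 0 J" "finite J" "card J = r - 2"
    using assms by (auto simp: J_def)
  have "(\<Sum>P\<in>tuples {..<r} (int_box B). (\<Prod>i<r. uw i (P i)) * of_bool (steep_at N (P j) (P l) \<and> \<not> small N (P 0)))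
     \<le> (2 * hs B ^ 2 / N) * (\<Sum>P\<in>tuples (insert 0 J) (int_box B). (\<Prod>i\<in>insert 0 J. uw i (P i)) * of_bool (\<not> small N (P 0)))"
    unfolding J(1)
    using sum_steep_at[OF N B tuples_box] assms J
    by (intro sum_tuples_peel) (auto simp: uw_def of_bool_conj)
  also have "\<dots> \<le> (2 * hs B ^ 2 / N) * ((4 * hs B ^ 2 / N) * (\<Sum>P\<in>tuples J (int_box B). (\<Prod>i\<in>J. uw i (P i)) * 1))"
    using sum_not_small_cube[OF N B]  assms J
    by (intro mult_left_mono sum_tuples_peel) (auto simp: uw_def)
  also have "\<dots> \<le> (2 * hs B ^ 2 / N) * ((4 * hs B ^ 2 / N) * hs B ^ (2 * (r - 2)))"
    using sum_tuples_uw[OF J(4)] J(5) by (intro mult_left_mono) auto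
  also have "\<dots> = 8 * (hs B ^ 2 * hs B ^ 2 * hs B ^ (2 * (r - 2))) / N^2" by (simp add: power2_eq_square)
  also have "hs B ^ 2 * hs B ^ 2 * hs B ^ (2 * (r - 2)) = hs B ^ (2 * r)"
    unfolding power_add [symmetric] using assms by (intro arg_cong[of _ _ "power _"]) auto
  finally show ?thesis .
qed

text \<open>The order of summation is forced: \<open>j\<close> first, uniformly in
  \<open>P l\<close> (even if \<open>l = i\<close>), then \<open>i\<close>, which leaves the width
  of the strip as a factor on \<open>P 0\<close>, and index 0 last, where the third power absorbs
  this factor. Hence 2 * 12 = 24.\<close>

lemma sum_tuples_steep_at_far:
  assumes "j \<in> {1..<r}" "l \<noteq> j" "i \<in> {1..<r} - {j}"
  shows "(\<Sum>P\<in>tuples {..<r} (int_box B). (\<Prod>i<r. uw i (P i)) * of_bool (steep_at N (P j) (P l) \<and> far N (P 0) (P i)))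
            \<le> 24 * hs B ^ (2 * r) / N^2"
proof -
  define J where "J = {..<r} - {0, i, j}"
  have J: "{..<r} = insert j (insert i (insert 0 J))" "0 \<notin> J" "i \<notin> insert 0 J" "j \<notin> insert i (insert 0 J)" 
     "finite J" "card J = r - 3"
    using assms by (auto simp: J_def)
  have r: "r \<ge> 3" using assms by auto
  have "(\<Sum>P\<in>tuples {..<r} (int_box B). (\<Prod>i<r. uw i (P i)) * of_bool (steep_at N (P j) (P l) \<and> far N (P 0) (P i)))
     \<le> (2 * hs B ^ 2 / N) * (\<Sum>P\<in>tuples (insert i (insert 0 J)) (int_box B). (\<Prod>i\<in>insert i (insert 0 J). uw i (P i)) * of_bool (far N (P 0) (P i)))"
    unfolding J(1)
    using sum_steep_at[OF N B tuples_box] assms J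
    by (intro sum_tuples_peel) (auto simp: uw_def of_bool_conj)
  also have "\<dots> \<le> (2 * hs B ^ 2 / N) * ((12 * hs B ^ 2 / N) * (\<Sum>P\<in>tuples (insert 0 J) (int_box B). (\<Prod>i\<in>insert 0 J. uw i (P i)) * mx (fst (P 0))))"
    using sum_far[OF N B tuples_box] assms J
    by (intro mult_left_mono sum_tuples_peel) (auto simp: uw_def far_def)
  also have "\<dots> \<le> (2 * hs B ^ 2 / N) * ((12 * hs B ^ 2 / N) * (hs B ^ 2 * (\<Sum>P\<in>tuples J (int_box B). (\<Prod>i\<in>J. uw i (P i)) * 1)))"
    using sum_wt3_mx[OF B] assms J
    by (intro mult_left_mono sum_tuples_peel) (auto simp: uw_def)
  also have "\<dots> \<le> (2 * hs B ^ 2 / N) * ((12 * hs B ^ 2 / N) * (hs B ^ 2 * hs B ^ (2 * (r - 3))))"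
    using sum_tuples_uw[OF J(5)] J(6) by (intro mult_left_mono) auto
  also have "\<dots> = 24 * (hs B ^ 2 * hs B ^ 2 * hs B ^ 2 * hs B ^ (2 * (r - 3))) / N^2" by (simp add: power2_eq_square)
  also have "hs B ^ 2 * hs B ^ 2 * hs B ^ 2 * hs B ^ (2 * (r - 3)) = hs B ^ (2 * r)"
    unfolding power_add [symmetric] using r by (intro arg_cong[of _ _ "power _"]) auto
  finally show ?thesis .
qed

text \<open>This is the price of the shift by a neighbour \<open>P l\<close> of the lone point
  \<open>P j\<close>. For \<open>l = 0\<close> the third power pays directly; for another remaining
  index the strip pays first and then the third power; an index outside the tuple, such as
  \<open>l = r\<close>, carries the value 0 of weight 1.\<close>

lemma sum_tuples_strip:
  assumes "j \<in> {1..<r}" 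
  shows "(\<Sum>P\<in>tuples ({..<r} - {j}) (int_box B). (\<Prod>i\<in>{..<r} - {j}. uw i (P i)) * (wt (P l) * of_bool (strip (P 0) (P l))))
            \<le> 2 * hs B ^ (2 * r)"
proof -
  consider "l = 0" | "l \<in> {..<r} - {j}" "l \<noteq> 0" | "l \<notin> {..<r} - {j}" "l \<noteq> 0" by blast
  then show ?thesis
  proof cases
    case 1
    define J where "J = {..<r} - {0, j}"
    have J: "{..<r} - {j} = insert 0 J" "0 \<notin> J" "finite J" "card J = r - 2"
      using assms by (auto simp: J_def)
    have "(\<Sum>P\<in>tuples ({..<r} - {j}) (int_box B). (\<Prod>i\<in>{..<r} - {j}. uw i (P i)) * (wt (P l) * of_bool (strip (P 0) (P l))))
       \<le> hs B ^ 2 * (\<Sum>P\<in>tuples J (int_box B). (\<Prod>i\<in>J. uw i (P i)) * 1)"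
      unfolding J(1)
    proof (intro sum_tuples_peel)
      fix P
      have "(\<Sum>x\<in>int_box B. uw 0 x * (wt ((P(0 := x)) l) * of_bool (strip ((P(0 := x)) 0) ((P(0 := x)) l))))
           \<le> (\<Sum>x\<in>int_box B. 1 / wt x ^ 3 * wt x)" by (intro sum_mono) (auto simp: uw_def 1)
      also have "\<dots> \<le> hs B ^ 2 * 1" using sum_wt3_wt[OF B] by simp
      finally show "(\<Sum>x\<in>int_box B. uw 0 x * (wt ((P(0 := x)) l) * of_bool (strip ((P(0 := x)) 0) ((P(0 := x)) l)))) \<le> hs B ^ 2 * 1" .
    qed (use J in auto)
    also have "\<dots> \<le> hs B ^ 2 * hs B ^ (2 * (r - 2))"
      using sum_tuples_uw[OF J(3)] J(4) by (intro mult_left_mono) auto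
    also have "\<dots> \<le> hs B ^ (2 * r)"
      unfolding power_add [symmetric] using assms by (intro hs_power_mono) auto
    also have "\<dots> \<le> 2 * hs B ^ (2 * r)" using B by simp
    finally show ?thesis .
  next
    case 2
    define J where "J = {..<r} - {0, l, j}"
    have J: "{..<r} - {j} = insert l (insert 0 J)" "0 \<notin> J" "l \<notin> insert 0 J" "finite J" "card J = r - 3"
      using assms 2 by (auto simp: J_def)
    have r: "r \<ge> 3" using assms 2 by auto
    have "(\<Sum>P\<in>tuples ({..<r} - {j}) (int_box B). (\<Prod>i\<in>{..<r} - {j}. uw i (P i)) * (wt (P l) * of_bool (strip (P 0) (P l))))
       \<le> (2 * hs B) * (\<Sum>P\<in>tuples (insert 0 J) (int_box B). (\<Prod>i\<in>insert 0 J. uw i (P i)) * mx (fst (P 0)))"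
      unfolding J(1) using sum_strip_wt[OF B tuples_box] 2 J
      by (intro sum_tuples_peel) (auto simp: uw_def)
    also have "\<dots> \<le> (2 * hs B) * (hs B ^ 2 * (\<Sum>P\<in>tuples J (int_box B). (\<Prod>i\<in>J. uw i (P i)) * 1))"
      using sum_wt3_mx[OF B] assms J B
      by (intro mult_left_mono sum_tuples_peel) (auto simp: uw_def)
    also have "\<dots> \<le> (2 * hs B) * (hs B ^ 2 * hs B ^ (2 * (r - 3)))"
      using sum_tuples_uw[OF J(4)] J(5) B by (intro mult_left_mono) auto
    also have "\<dots> = 2 * hs B ^ (1 + 2 + 2 * (r - 3))" unfolding power_add by simp
    also have "\<dots> \<le> 2 * hs B ^ (2 * r)"
      using r by (intro mult_left_mono hs_power_mono) auto
    finally show ?thesis .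
  next
    case 3
    have "(\<Sum>P\<in>tuples ({..<r} - {j}) (int_box B). (\<Prod>i\<in>{..<r} - {j}. uw i (P i)) * (wt (P l) * of_bool (strip (P 0) (P l))))
        \<le> (\<Sum>P\<in>tuples ({..<r} - {j}) (int_box B). (\<Prod>i\<in>{..<r} - {j}. uw i (P i)) * 1)"
    proof (intro sum_mono mult_left_mono prod_nonneg)
      fix P assume "P \<in> tuples ({..<r} - {j}) (int_box B)"
      then have "P l = 0" using 3 by (auto simp: tuples_def)
      then show "wt (P l) * of_bool (strip (P 0) (P l)) \<le> 1" by simp
    qed auto
    also have "\<dots> \<le> hs B ^ (2 * card ({..<r} - {j}))" using sum_tuples_uw[of "{..<r} - {j}"] by simp
    also have "\<dots> \<le> hs B ^ (2 * r)" by (intro hs_power_mono) (auto intro: order.trans[OF card_Diff1_le])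
    also have "\<dots> \<le> 2 * hs B ^ (2 * r)" using B by simp
    finally show ?thesis .
  qed
qed

end

lemma of_bool_Bex_le: "finite A \<Longrightarrow> of_bool (\<exists>x\<in>A. Q x) \<le> (\<Sum>x\<in>A. of_bool (Q x) :: real)"
proof -
  assume A: "finite A"
  show ?thesis
  proof (cases "\<exists>x\<in>A. Q x")
    case True
    then obtain x where "x \<in> A" "Q x" by blast
    then show ?thesis using member_le_sum[of x A "\<lambda>x. of_bool (Q x) :: real"] A True by auto
  qed (auto intro: sum_nonneg)
qed

lemma of_bool_disj_le3:
  "(P \<Longrightarrow> Q1 \<or> Q2 \<or> Q3) \<Longrightarrow> of_bool P \<le> of_bool Q1 + (of_bool Q2 + of_bool Q3 :: real)"
  by auto

context
  fixes N :: nat and B :: int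
  assumes N: "N \<ge> 1" and B: "B \<ge> 0"
begin

text \<open>A union bound: 4, 8 and 24 are the constants of the three configurations, multiplied by
  crude counts of the pairs \<open>(j, l)\<close> and triples \<open>(j, l, i)\<close>.\<close>

lemma sum_tuples_bad:
  assumes "r \<ge> 1"
  shows "(\<Sum>P\<in>tuples {..<r} (int_box B). (\<Prod>i<r. uw i (P i)) * of_bool (bad N r P))
            \<le> real (4 + r * (r + 1) * 8 + r * (r + 1) * r * 24) * hs B ^ (2 * r) / N^2"
proof -
  let ?T = "tuples {..<r} (int_box B)" and ?u = "\<lambda>P. \<Prod>i<r. uw i (P i)" and ?X = "hs B ^ (2 * r) / N^2"
  have X: "?X \<ge> 0" using B by simp
  have u: "?u P \<ge> 0" for P by (intro prod_nonneg) auto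
  let ?JL = "Sigma {1..<r} (\<lambda>j. {..r} - {j})" and ?JLI = "Sigma {1..<r} (\<lambda>j. ({..r} - {j}) \<times> ({1..<r} - {j}))"
  have cJL: "real (card ?JL) \<le> r * (r + 1)"
  proof -
    have "card ?JL \<le> card ({..<r} \<times> {..r})" by (intro card_mono) auto
    also have "\<dots> = r * (r + 1)" by (simp add: card_cartesian_product)
    finally have "real (card ?JL) \<le> real (r * (r + 1))" by (rule of_nat_mono)
    then show ?thesis by (simp only: of_nat_mult)
  qed
  have cJLI: "real (card ?JLI) \<le> r * (r + 1) * r"
  proof -
    have "card ?JLI \<le> card ({..<r} \<times> ({..r} \<times> {..<r}))" by (intro card_mono) auto
    also have "\<dots> = r * (r + 1) * r" by (simp add: card_cartesian_product mult_ac)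
    finally have "real (card ?JLI) \<le> real (r * (r + 1) * r)" by (rule of_nat_mono)
    then show ?thesis by (simp only: of_nat_mult)
  qed
  have "of_bool (bad N r P) \<le> of_bool (steep_at N (P 0) (P 1)) +
        ((\<Sum>(j, l)\<in>?JL. of_bool (steep_at N (P j) (P l) \<and> \<not> small N (P 0))) +
         (\<Sum>(j, l, i)\<in>?JLI. of_bool (steep_at N (P j) (P l) \<and> far N (P 0) (P i)) :: real))" for P
  proof -
    have "of_bool (bad N r P) \<le> of_bool (steep_at N (P 0) (P 1)) +
        (of_bool (\<exists>x\<in>?JL. steep_at N (P (fst x)) (P (snd x)) \<and> \<not> small N (P 0)) +
         of_bool (\<exists>x\<in>?JLI. steep_at N (P (fst x)) (P (fst (snd x))) \<and> far N (P 0) (P (snd (snd x)))) :: real)"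
    proof (intro of_bool_disj_le3)
      assume "bad N r P"
      then consider "steep_at N (P 0) (P 1)"
        | j l where "(j, l) \<in> ?JL" "steep_at N (P j) (P l)" "\<not> small N (P 0)"
        | j l i where "(j, l, i) \<in> ?JLI" "steep_at N (P j) (P l)" "far N (P 0) (P i)"
        unfolding bad_def by blast
      then show "steep_at N (P 0) (P 1) \<or>
          (\<exists>x\<in>?JL. steep_at N (P (fst x)) (P (snd x)) \<and> \<not> small N (P 0)) \<or>
          (\<exists>x\<in>?JLI. steep_at N (P (fst x)) (P (fst (snd x))) \<and> far N (P 0) (P (snd (snd x))))"
      proof cases
        case 2
        then show ?thesis by (intro disjI2 disjI1 bexI[of _ "(j, l)"]) simp_all
      next
        case 3
        then show ?thesis by (intro disjI2 bexI[of _ "(j, l, i)"]) simp_all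
      qed simp
    qed
    also have "\<dots> \<le> of_bool (steep_at N (P 0) (P 1)) +
        ((\<Sum>x\<in>?JL. of_bool (steep_at N (P (fst x)) (P (snd x)) \<and> \<not> small N (P 0))) +
         (\<Sum>x\<in>?JLI. of_bool (steep_at N (P (fst x)) (P (fst (snd x))) \<and> far N (P 0) (P (snd (snd x))))))"
      by (intro add_mono order.refl of_bool_Bex_le) auto
    finally show ?thesis by (simp add: case_prod_beta)
  qed
  then have "(\<Sum>P\<in>?T. ?u P * of_bool (bad N r P)) \<le> (\<Sum>P\<in>?T. ?u P * (of_bool (steep_at N (P 0) (P 1)) +
        ((\<Sum>(j, l)\<in>?JL. of_bool (steep_at N (P j) (P l) \<and> \<not> small N (P 0))) +
         (\<Sum>(j, l, i)\<in>?JLI. of_bool (steep_at N (P j) (P l) \<and> far N (P 0) (P i))))))"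
    by (intro sum_mono mult_left_mono u)
  also have "\<dots> = (\<Sum>P\<in>?T. ?u P * of_bool (steep_at N (P 0) (P 1)))
      + ((\<Sum>(j, l)\<in>?JL. \<Sum>P\<in>?T. ?u P * of_bool (steep_at N (P j) (P l) \<and> \<not> small N (P 0)))
      + (\<Sum>(j, l, i)\<in>?JLI. \<Sum>P\<in>?T. ?u P * of_bool (steep_at N (P j) (P l) \<and> far N (P 0) (P i))))"
    unfolding distrib_left sum.distrib sum_distrib_left case_prod_beta
    by (subst (2 4) sum.swap) (rule refl)
  also have "\<dots> \<le> 4 * ?X + ((\<Sum>x\<in>?JL. 8 * ?X) + (\<Sum>x\<in>?JLI. 24 * ?X))"
  proof (intro add_mono sum_mono)
    show "(\<Sum>P\<in>?T. ?u P * of_bool (steep_at N (P 0) (P 1))) \<le> 4 * ?X"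
      using sum_tuples_steep_at_0[OF N B assms] by simp
    fix x assume "x \<in> ?JL"
    then obtain j l where "x = (j, l)" "j \<in> {1..<r}" "l \<noteq> j" by blast
    then show "(case x of (j, l) \<Rightarrow> \<Sum>P\<in>?T. ?u P * of_bool (steep_at N (P j) (P l) \<and> \<not> small N (P 0))) \<le> 8 * ?X"
      using sum_tuples_steep_at_not_small[OF N B, of j r l] by simp
  next
    fix x assume "x \<in> ?JLI"
    then obtain j l i where "x = (j, l, i)" "j \<in> {1..<r}" "l \<noteq> j" "i \<in> {1..<r} - {j}" by blast
    then show "(case x of (j, l, i) \<Rightarrow> \<Sum>P\<in>?T. ?u P * of_bool (steep_at N (P j) (P l) \<and> far N (P 0) (P i))) \<le> 24 * ?X"
      using sum_tuples_steep_at_far[OF N B, of j r l i] by simp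
  qed
  also have "\<dots> \<le> 4 * ?X + (r * (r + 1) * (8 * ?X) + r * (r + 1) * r * (24 * ?X))"
    unfolding sum_constant using cJL cJLI X
    by (intro add_mono mult_right_mono order.refl) auto
  also have "\<dots> = real (4 + r * (r + 1) * 8 + r * (r + 1) * r * 24) * hs B ^ (2 * r) / N^2"
    by (simp add: algebra_simps add_divide_distrib)
  finally show ?thesis by simp
qed

end

section \<open>Cancellation for a single large point\<close>

definition lam :: "complex \<Rightarrow> int \<times> int \<Rightarrow> complex" where
  "lam \<tau> p = lattice_point \<tau> (fst p) (snd p)"

lemma lam_add: "lam \<tau> (p + q) = lam \<tau> p + lam \<tau> q"
  by (simp add: lam_def lattice_point_def algebra_simps)

lemma lam_minus: "lam \<tau> (- p) = - lam \<tau> p"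
  by (simp add: lam_def lattice_point_def)

lemma lam_0 [simp]: "lam \<tau> 0 = 0"
  by (simp add: lam_def lattice_point_def)

definition disc :: "nat \<Rightarrow> int \<times> int \<Rightarrow> complex" where
  "disc N d = of_bool (posN N d) - of_bool (pos0 d)"

text \<open>Each cone contains exactly one of \<open>d\<close> and \<open>- d\<close> for nonzero
  \<open>d\<close>, so both indicators turn into their complements and the constants 1
  cancel.\<close>

lemma disc_minus: "disc N (- d) = - disc N d"
  by (cases "d = 0") (auto simp: disc_def pos0_total posN_total)

lemma disc_minus_commute: "disc N (p - q) = - disc N (q - p)"
  using disc_minus[of N "q - p"] by simp

lemma norm_disc_le: "norm (disc N d) \<le> of_bool (wedge N d)"
  using pos_eq_or_wedge[of N d] by (auto simp: disc_def)

lemma small_minus [simp]: "small N (- p) = small N p"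
  by (simp add: small_def)

lemma wt_add_small:
  assumes "N \<ge> 1" "small N p"
  shows "wt (x + p) \<le> wt x + real N / 4"
proof -
  have p: "\<bar>real_of_int (fst p)\<bar> \<le> real N / 4" "\<bar>real_of_int (snd p)\<bar> \<le> real N / 4"
    using assms unfolding small_def by linarith+
  have "\<bar>real_of_int (fst x) + real_of_int (fst p)\<bar> \<le> wt x + real N / 4"
       "\<bar>real_of_int (snd x) + real_of_int (snd p)\<bar> \<le> wt x + real N / 4"
       "1 \<le> wt x + real N / 4"
    using p mx_ge(2)[of "fst x"] mx_ge(2)[of "snd x"] wt_ge(1-3)[of x] by linarith+
  then show ?thesis unfolding wt_def[of "x + p"] mx_def[of "fst (x + p)"] mx_def[of "snd (x + p)"] by simp
qed

lemma wt_less_add_small: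
  assumes "N \<ge> 1" "small N p"
  shows "wt x \<le> wt (x + p) + real N / 4"
  using wt_add_small[of N "- p" "x + p"] assms by simp

lemma in_box_iff: "B \<ge> 1 \<Longrightarrow> x \<in> int_box B \<longleftrightarrow> wt x \<le> real_of_int B"
  by (cases x) (auto simp: int_box_def wt_def mx_def)

text \<open>The Lipschitz bound for powers on the unit disc, rescaled to radius \<rho>.\<close>

lemma norm_power_diff_le:
  fixes x y :: complex
  assumes "norm x \<le> \<rho>" "norm y \<le> \<rho>" "\<rho> > 0"
  shows "norm (x ^ k - y ^ k) \<le> real k * norm (x - y) * \<rho> ^ (k - 1)"
proof (cases k)
  case (Suc m)
  have "norm ((x / \<rho>) ^ k - (y / \<rho>) ^ k) \<le> real k * norm (x / \<rho> - y / \<rho>)"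
    using assms by (intro norm_power_diff) (auto simp: norm_divide divide_simps)
  moreover have "(x / \<rho>) ^ k - (y / \<rho>) ^ k = (x ^ k - y ^ k) / \<rho> ^ k"
    by (simp add: power_divide diff_divide_distrib)
  moreover have "x / \<rho> - y / \<rho> = (x - y) / \<rho>" by (simp add: diff_divide_distrib)
  ultimately have "norm (x ^ k - y ^ k) / \<rho> ^ k \<le> real k * (norm (x - y) / \<rho>)"
    using assms by (simp add: norm_divide norm_power)
  then show ?thesis using assms Suc by (simp add: field_simps)
qed simp

text \<open>All estimates see \<tau> only through this comparison of \<open>|\<lambda>|\<close> with
  the weight. Locally uniform bounds in \<tau> therefore reduce to choosing \<open>c\<close> and
  \<open>C0\<close> uniformly on a compact set.\<close>

locale lattice_bounds =
  fixes \<tau> :: complex and c C0 :: real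
  assumes c: "0 < c" "c \<le> 1"
    and lower: "\<And>p. p \<noteq> 0 \<Longrightarrow> c * wt p \<le> norm (lam \<tau> p)"
    and upper: "\<And>p. norm (lam \<tau> p) \<le> C0 * wt p"
begin

lemma C0_nonneg: "0 \<le> C0"
  using upper[of 0] by simp

lemma lam_nonzero: "p \<noteq> 0 \<Longrightarrow> lam \<tau> p \<noteq> 0"
proof
  assume "p \<noteq> 0" "lam \<tau> p = 0"
  then have "c * wt p \<le> 0" using lower[of p] by simp
  moreover have "0 < c * wt p" using c by (intro mult_pos_pos) auto
  ultimately show False by linarith
qed

lemma norm_inverse_lam_le: "norm (1 / lam \<tau> p) \<le> (1 / c) / wt p"
\<comment> \<open>At \<open>p = 0\<close> the left-hand side is 0 by the convention for division by
  zero.\<close>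
proof (cases "p = 0")
  case True
  then show ?thesis using c by simp
next
  case False
  have "1 / norm (lam \<tau> p) \<le> 1 / (c * wt p)"
    using lower[OF False] lam_nonzero[OF False] c by (intro divide_left_mono mult_pos_pos) auto
  then show ?thesis by (simp add: norm_divide)
qed

lemma norm_term_le:
  assumes "j \<le> k"
  shows "norm (1 / lam \<tau> p ^ k) \<le> (1 / c) ^ k * (1 / wt p ^ j)"
proof -
  have "norm (1 / lam \<tau> p ^ k) = norm (1 / lam \<tau> p) ^ k"
    by (simp add: norm_power norm_divide power_divide)
  also have "\<dots> \<le> ((1 / c) / wt p) ^ k"
    by (intro power_mono norm_inverse_lam_le) auto
  also have "\<dots> = (1 / c) ^ k * (1 / wt p ^ k)" by (simp add: power_divide power_mult_distrib)
  also have "\<dots> \<le> (1 / c) ^ k * (1 / wt p ^ j)"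
    using c assms by (intro mult_left_mono divide_left_mono power_increasing mult_pos_pos) auto
  finally show ?thesis .
qed

text \<open>A wedge point has weight at least N, so translation by a small \<open>p\<close> keeps it
  comparable to itself. Differencing then costs |p| and gains one power of the weight, so the cubic
  decay that suffices for N^-2 is available already for \<open>k = 2\<close>.\<close>

lemma term_diff_le:
  assumes N: "N \<ge> 1" and d: "wedge N d" and p: "small N p" and k: "k \<ge> 2"
  shows "norm (1 / lam \<tau> (d + p) ^ k - 1 / lam \<tau> d ^ k) \<le> real k * C0 * (2 / c) ^ (k + 1) * wt p * (1 / wt d ^ 3)"
proof -
  have "real N * 1 \<le> real N * mx (fst d)" by (intro mult_left_mono) auto
  then have wN: "real N \<le> wt d" using wedge_bounds[OF N d] by linarith
  have w2: "wt d / 2 \<le> wt (d + p)" using wt_less_add_small[OF N p, of d] wN by linarith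
  have d0: "d \<noteq> 0" using d by (auto simp: wedge_def)
  have dp0: "d + p \<noteq> 0"
  proof
    assume "d + p = 0"
    then have "d = - p" by (simp add: add_eq_0_iff2)
    then have "small N d" using p by simp
    moreover have "steep_at N d 0" using N d by (intro wedge_steep_at) auto
    ultimately show False using steep_at_not_small[OF N] by blast
  qed
  \<comment> \<open>A common bound for both reciprocals; the 2 accounts for \<open>d + p\<close>
    having at least half the weight of \<open>d\<close>.\<close>
  define \<rho> where "\<rho> = (2 / c) / wt d"
  have \<rho>: "\<rho> > 0" using c by (simp add: \<rho>_def)
  have 1: "norm (1 / lam \<tau> d) \<le> (1 / c) / wt d" by (rule norm_inverse_lam_le)
  also have "\<dots> \<le> \<rho>" unfolding \<rho>_def using c by (intro divide_right_mono) auto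
  finally have y: "norm (1 / lam \<tau> d) \<le> \<rho>" .
  have "norm (1 / lam \<tau> (d + p)) \<le> (1 / c) / wt (d + p)" by (rule norm_inverse_lam_le)
  also have "\<dots> \<le> (1 / c) / (wt d / 2)" using c w2 by (intro divide_left_mono mult_pos_pos) auto
  finally have x: "norm (1 / lam \<tau> (d + p)) \<le> \<rho>" by (simp add: \<rho>_def)
  have nz: "lam \<tau> d \<noteq> 0" "lam \<tau> (d + p) \<noteq> 0"
    using d0 dp0 lam_nonzero by auto
  have "1 / lam \<tau> (d + p) - 1 / lam \<tau> d = - lam \<tau> p * ((1 / lam \<tau> (d + p)) * (1 / lam \<tau> d))"
    using nz by (simp add: field_simps lam_add)
  then have "norm (1 / lam \<tau> (d + p) - 1 / lam \<tau> d) = norm (lam \<tau> p) * (norm (1 / lam \<tau> (d + p)) * norm (1 / lam \<tau> d))"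
    by (simp only: norm_mult norm_minus_cancel)
  also have "\<dots> \<le> (C0 * wt p) * (\<rho> * \<rho>)"
    using upper x y \<rho> C0_nonneg by (intro mult_mono) auto
  finally have D: "norm (1 / lam \<tau> (d + p) - 1 / lam \<tau> d) \<le> C0 * wt p * \<rho> ^ 2" by (simp add: power2_eq_square)
  have "norm ((1 / lam \<tau> (d + p)) ^ k - (1 / lam \<tau> d) ^ k)
      \<le> real k * norm (1 / lam \<tau> (d + p) - 1 / lam \<tau> d) * \<rho> ^ (k - 1)"
    by (rule norm_power_diff_le[OF x y \<rho>])
  also have "\<dots> \<le> real k * (C0 * wt p * \<rho> ^ 2) * \<rho> ^ (k - 1)"
    using D \<rho> by (intro mult_right_mono mult_left_mono) auto
  also have "\<dots> = real k * C0 * wt p * \<rho> ^ (2 + (k - 1))" by (simp only: power_add mult_ac)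
  also have "2 + (k - 1) = k + 1" using k by simp
  also have "real k * C0 * wt p * \<rho> ^ (k + 1) = real k * C0 * wt p * ((2 / c) ^ (k + 1) * (1 / wt d ^ (k + 1)))"
    by (simp only: \<rho>_def power_divide[of "2 / c"]) simp
  also have "\<dots> \<le> real k * C0 * wt p * ((2 / c) ^ (k + 1) * (1 / wt d ^ 3))"
    using k c C0_nonneg by (intro mult_left_mono divide_left_mono power_increasing mult_pos_pos mult_nonneg_nonneg) auto
  finally show ?thesis by (simp add: power_divide mult_ac)
qed

text \<open>Here 241 = 1 + 120 + 120: the unshifted sum and the two boundary corrections from moving
  the box. The second summand is the cost of shifting the terms.\<close>

definition KT :: "nat \<Rightarrow> real" where
  "KT k = 241 * (1 / c) ^ k + real k * C0 * (2 / c) ^ (k + 1)"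

lemma KT_nonneg: "KT k \<ge> 0"
  using c C0_nonneg unfolding KT_def by (intro add_nonneg_nonneg mult_nonneg_nonneg) auto

end

locale lattice_box = lattice_bounds +
  fixes N :: nat and B :: int
  assumes N: "N \<ge> 1" and B: "int N ^ 3 \<le> B"
begin

lemma B_ge: "int N \<le> B" "1 \<le> B" "0 \<le> B"
proof -
  have "int N ^ 1 \<le> int N ^ 3" using N by (intro power_increasing) auto
  then show "int N \<le> B" using B by (simp only: power_one_right)
  then show "1 \<le> B" "0 \<le> B" using N by auto
qed

lemma sum_disc_0:
  assumes "k \<ge> 2"
  shows "norm (\<Sum>x\<in>int_box B. disc N x * (1 / lam \<tau> x ^ k)) \<le> (1 / c) ^ k * hs B ^ 2 / N^2"
proof (cases "even k")
  case True
  have "(\<Sum>x\<in>int_box B. disc N x * (1 / lam \<tau> x ^ k)) = (\<Sum>x\<in>int_box B. disc N (- x) * (1 / lam \<tau> (- x) ^ k))"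
    by (intro sum.reindex_bij_witness[of _ uminus uminus]) (auto simp: int_box_def)
  also have "\<dots> = - (\<Sum>x\<in>int_box B. disc N x * (1 / lam \<tau> x ^ k))"
    using True by (simp add: disc_minus lam_minus sum_negf)
  finally show ?thesis using c by (simp add: equation_minus_iff)
next
  case False
  with assms have k: "k \<ge> 3" by (cases "k = 2") auto
  have "norm (\<Sum>x\<in>int_box B. disc N x * (1 / lam \<tau> x ^ k)) \<le> (\<Sum>x\<in>int_box B. norm (disc N x * (1 / lam \<tau> x ^ k)))"
    by (rule norm_sum)
  also have "\<dots> \<le> (\<Sum>x\<in>int_box B. of_bool (wedge N x) * ((1 / c) ^ k * (1 / wt x ^ 3)))"
    unfolding norm_mult by (intro sum_mono mult_mono norm_disc_le norm_term_le k) auto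
  also have "\<dots> = (1 / c) ^ k * (\<Sum>x\<in>int_box B. 1 / wt x ^ 3 * of_bool (wedge N x))"
    by (simp add: sum_distrib_left mult_ac)
  also have "\<dots> \<le> (1 / c) ^ k * (hs B ^ 2 / N^2)"
    using c by (intro mult_left_mono sum_wedge_cube N B_ge) auto
  finally show ?thesis by simp
qed

text \<open>Points that can enter or leave the box under a small shift.\<close>

definition edge :: "(int \<times> int) set" where
  "edge = {d. wedge N d \<and> real_of_int B / 2 \<le> wt d \<and> 
     real_of_int B - real N / 4 \<le> wt d \<and> wt d \<le> real_of_int B + real N / 4}"

text \<open>In the wedge the weight is the absolute second coordinate, which must lie near
  \<open>B\<close> or \<open>- B\<close>. This leaves O(N) values for it and O(\<open>B\<close>) for
  the first coordinate; 30 = 5 * 6 bounds the product.\<close>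

lemma card_edge: "finite edge" "real (card edge) \<le> 30 * real_of_int B * real N"
proof -
  let ?R = "{-2*B..2*B} \<times> ({B - int N..B + int N} \<union> {- B - int N..- B + int N})"
  have sub: "edge \<subseteq> ?R"
  proof
    fix d assume "d \<in> edge"
    then have d: "wedge N d" "real_of_int B - real N / 4 \<le> wt d" "wt d \<le> real_of_int B + real N / 4"
      by (auto simp: edge_def)
    have "1 * \<bar>fst d\<bar> \<le> int N * \<bar>fst d\<bar>" using N by (intro mult_right_mono) auto
    then have ab: "\<bar>fst d\<bar> \<le> \<bar>snd d\<bar>" "fst d \<noteq> 0" using d(1) unfolding wedge_def by linarith+
    then have "wt d = \<bar>real_of_int (snd d)\<bar>" unfolding wt_def mx_def by linarith
    then show "d \<in> ?R" using ab d B_ge by (cases d) (simp, linarith)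
  qed
  then show "finite edge" by (rule finite_subset) auto
  have "card edge \<le> card ?R" by (intro card_mono sub) auto
  also have "\<dots> = card {-2*B..2*B} * card ({B - int N..B + int N} \<union> {- B - int N..- B + int N})"
    by (rule card_cartesian_product)
  also have "\<dots> \<le> card {-2*B..2*B} * (card {B - int N..B + int N} + card {- B - int N..- B + int N})"
    by (intro mult_left_mono card_Un_le) auto
  also have "\<dots> = nat (4 * B + 1) * (2 * nat (2 * int N + 1))" by (simp add: algebra_simps)
  finally have "real (card edge) \<le> real (nat (4 * B + 1) * (2 * nat (2 * int N + 1)))" by (rule of_nat_mono)
  also have "\<dots> = (4 * real_of_int B + 1) * (2 * (2 * real N + 1))" using B_ge by simp
  also have "\<dots> \<le> (5 * real_of_int B) * (2 * (3 * real N))"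
    using B_ge N by (intro mult_mono) auto
  finally show "real (card edge) \<le> 30 * real_of_int B * real N" by simp
qed

text \<open>Here \<open>g\<close> will be the identity or the translation by \<open>p\<close>,
  whichever lands in the box. At most 30 \<open>B\<close> N terms of size at most 4 /
  \<open>B\<close>^2, up to the power of 1 / \<open>c\<close>, give 120 N / \<open>B\<close>; this
  is where \<open>B\<close> >= N^3 enters.\<close>

lemma sum_edge:
  assumes "\<And>d. d \<in> A \<Longrightarrow> wedge N d \<Longrightarrow> d \<in> edge" "finite A"
    and "\<And>d. d \<in> edge \<Longrightarrow> d \<in> A \<Longrightarrow> real_of_int B / 2 \<le> wt (g d)" "k \<ge> 2"
  shows "norm (\<Sum>d\<in>A. disc N d * (1 / lam \<tau> (g d) ^ k)) \<le> 120 * (1 / c) ^ k / N^2"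
proof -
  have B0: "0 < real_of_int B" using B_ge by linarith
  have "norm (\<Sum>d\<in>A. disc N d * (1 / lam \<tau> (g d) ^ k)) \<le> (\<Sum>d\<in>A. norm (disc N d * (1 / lam \<tau> (g d) ^ k)))"
    by (rule norm_sum)
  also have "\<dots> = (\<Sum>d\<in>A \<inter> edge. norm (disc N d * (1 / lam \<tau> (g d) ^ k)))"
  proof (intro sum.mono_neutral_right ballI)
    fix d assume "d \<in> A - A \<inter> edge"
    then have "\<not> wedge N d" using assms(1)[of d] by blast
    then show "norm (disc N d * (1 / lam \<tau> (g d) ^ k)) = 0" using norm_disc_le[of N d] by simp
  qed (use assms in auto)
  also have "\<dots> \<le> (\<Sum>d\<in>A \<inter> edge. (1 / c) ^ k * (4 / real_of_int B ^ 2))"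
  proof (intro sum_mono)
    fix d assume d: "d \<in> A \<inter> edge"
    then have "real_of_int B / 2 \<le> wt (g d)" using assms by auto
    then have w: "(real_of_int B / 2) ^ 2 \<le> wt (g d) ^ 2" using B0 by (intro power_mono) auto
    have "1 / wt (g d) ^ 2 \<le> 1 / (real_of_int B / 2) ^ 2"
      using B0 by (intro divide_left_mono w mult_pos_pos zero_less_power) auto
    then have w': "1 / wt (g d) ^ 2 \<le> 4 / real_of_int B ^ 2" by (simp add: power_divide)
    have "norm (disc N d) * norm (1 / lam \<tau> (g d) ^ k) \<le> 1 * ((1 / c) ^ k * (4 / real_of_int B ^ 2))"
    proof (intro mult_mono)
      show "norm (disc N d) \<le> 1" using norm_disc_le[of N d] by (auto simp: of_bool_def split: if_splits)
      have "norm (1 / lam \<tau> (g d) ^ k) \<le> (1 / c) ^ k * (1 / wt (g d) ^ 2)" by (rule norm_term_le) fact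
      also have "\<dots> \<le> (1 / c) ^ k * (4 / real_of_int B ^ 2)" using c w' by (intro mult_left_mono) auto
      finally show "norm (1 / lam \<tau> (g d) ^ k) \<le> (1 / c) ^ k * (4 / real_of_int B ^ 2)" .
    qed auto
    then show "norm (disc N d * (1 / lam \<tau> (g d) ^ k)) \<le> (1 / c) ^ k * (4 / real_of_int B ^ 2)"
      by (simp only: norm_mult)
  qed
  also have "\<dots> = real (card (A \<inter> edge)) * ((1 / c) ^ k * (4 / real_of_int B ^ 2))" by simp
  also have "\<dots> \<le> (30 * real_of_int B * real N) * ((1 / c) ^ k * (4 / real_of_int B ^ 2))"
  proof (intro mult_right_mono)
    have "real (card (A \<inter> edge)) \<le> real (card edge)" using card_edge(1) by (intro of_nat_mono card_mono) auto
    then show "real (card (A \<inter> edge)) \<le> 30 * real_of_int B * real N" using card_edge(2) by linarith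
  qed (use c in auto)
  also have "\<dots> = 120 * (1 / c) ^ k * (real N / real_of_int B)" using B0 by (simp add: power2_eq_square)
  also have "\<dots> \<le> 120 * (1 / c) ^ k * (1 / N^2)"
  proof (intro mult_left_mono)
    have "real_of_int (int N ^ 3) \<le> real_of_int B" using B by (simp only: of_int_le_iff)
    then show "real N / real_of_int B \<le> 1 / real (N^2)"
      using B0 N by (simp add: field_simps power2_eq_square power3_eq_cube)
  qed (use c in auto)
  finally show ?thesis by simp
qed

text \<open>Substituting \<open>x = d + p\<close> moves the shift from the discontinuous factor
  \<open>disc\<close> to the smooth factor \<open>1 / lam \<tau> x ^ k\<close>, at the price of a
  translated domain of summation.\<close>

lemma sum_disc_small:
  assumes p: "small N p" and k: "k \<ge> 2"
  shows "norm (\<Sum>x\<in>int_box B. disc N (x - p) * (1 / lam \<tau> x ^ k)) \<le> KT k * hs B ^ 2 / N^2 * wt p"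
proof -
  let ?g = "\<lambda>x. 1 / lam \<tau> x ^ k"
  define D where "D = (\<lambda>x. x - p) ` int_box B"
  have finD: "finite D" by (simp add: D_def)
  have D_iff: "d \<in> D \<longleftrightarrow> d + p \<in> int_box B" for d
    unfolding D_def image_iff by (metis add_diff_cancel diff_add_cancel)
  have "(\<Sum>x\<in>int_box B. disc N (x - p) * ?g x) = (\<Sum>d\<in>D. disc N d * ?g (d + p))"
    unfolding D_def by (subst sum.reindex) (auto simp: inj_on_def)
  also have "\<dots> = (\<Sum>d\<in>D \<inter> int_box B. disc N d * ?g (d + p)) + (\<Sum>d\<in>D - int_box B. disc N d * ?g (d + p))"
    using finD by (rule sum.Int_Diff)
  also have "(\<Sum>d\<in>D \<inter> int_box B. disc N d * ?g (d + p)) =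
      (\<Sum>d\<in>D \<inter> int_box B. disc N d * (?g (d + p) - ?g d)) + (\<Sum>d\<in>D \<inter> int_box B. disc N d * ?g d)"
    unfolding sum.distrib [symmetric] by (intro sum.cong) (auto simp: algebra_simps)
  also have "(\<Sum>d\<in>D \<inter> int_box B. disc N d * ?g d) = (\<Sum>d\<in>int_box B. disc N d * ?g d) - (\<Sum>d\<in>int_box B - D. disc N d * ?g d)"
    using sum.Int_Diff[of "int_box B" "\<lambda>d. disc N d * ?g d" D] by (simp add: Int_commute)
  \<comment> \<open>Smooth difference on the common part of the two boxes, the unshifted sum over
    the full box, and two corrections near the boundary.\<close>
  finally have eq: "(\<Sum>x\<in>int_box B. disc N (x - p) * ?g x) =
      (\<Sum>d\<in>D \<inter> int_box B. disc N d * (?g (d + p) - ?g d)) +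
      ((\<Sum>d\<in>int_box B. disc N d * ?g d) - (\<Sum>d\<in>int_box B - D. disc N d * ?g d)) +
      (\<Sum>d\<in>D - int_box B. disc N d * ?g (d + p))" .
  let ?K = "real k * C0 * (2 / c) ^ (k + 1) * wt p"
  have K: "?K \<ge> 0" using C0_nonneg c by (intro mult_nonneg_nonneg) auto
  have n1: "norm (\<Sum>d\<in>D \<inter> int_box B. disc N d * (?g (d + p) - ?g d)) \<le> ?K * (hs B ^ 2 / N^2)"
  proof -
    have "norm (\<Sum>d\<in>D \<inter> int_box B. disc N d * (?g (d + p) - ?g d))
       \<le> (\<Sum>d\<in>D \<inter> int_box B. norm (disc N d * (?g (d + p) - ?g d)))" by (rule norm_sum)
    also have "\<dots> \<le> (\<Sum>d\<in>int_box B. norm (disc N d * (?g (d + p) - ?g d)))"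
      by (intro sum_mono2) auto
    also have "\<dots> \<le> (\<Sum>d\<in>int_box B. ?K * (1 / wt d ^ 3 * of_bool (wedge N d)))"
    proof (intro sum_mono)
      fix d
      show "norm (disc N d * (?g (d + p) - ?g d)) \<le> ?K * (1 / wt d ^ 3 * of_bool (wedge N d))"
      proof (cases "wedge N d")
        case True
        then have "norm (disc N d) \<le> 1" using norm_disc_le[of N d] by simp
        then have "norm (disc N d) * norm (?g (d + p) - ?g d) \<le> 1 * (?K * (1 / wt d ^ 3))"
          using term_diff_le[OF N True p k] by (intro mult_mono) auto
        then show ?thesis using True by (simp add: norm_mult)
      next
        case False
        then show ?thesis using norm_disc_le[of N d] by simp
      qed
    qed
    also have "\<dots> \<le> ?K * (hs B ^ 2 / N^2)"
      unfolding sum_distrib_left [symmetric] using K by (intro mult_left_mono sum_wedge_cube N B_ge) auto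
    finally show ?thesis .
  qed
  have BN: "real N \<le> real_of_int B" using B_ge by linarith
  have n3: "norm (\<Sum>d\<in>int_box B - D. disc N d * ?g d) \<le> 120 * (1 / c) ^ k / N^2"
  proof (rule sum_edge)
    fix d assume d: "d \<in> int_box B - D" "wedge N d"
    then have "wt d \<le> real_of_int B" "real_of_int B < wt (d + p)"
      using D_iff[of d] by (auto simp: in_box_iff B_ge)
    then show "d \<in> edge" using d BN wt_add_small[OF N p, of d] by (auto simp: edge_def)
  qed (auto simp: edge_def k)
  have n4: "norm (\<Sum>d\<in>D - int_box B. disc N d * ?g (d + p)) \<le> 120 * (1 / c) ^ k / N^2"
  proof (rule sum_edge)
    fix d assume d: "d \<in> D - int_box B"
    have *: "wt (d + p) \<le> real_of_int B" "real_of_int B < wt d"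
      using D_iff[of d] d by (auto simp: in_box_iff B_ge)
    show "real_of_int B / 2 \<le> wt (d + p)"
      using * BN wt_less_add_small[OF N p, of d] by linarith
    show "d \<in> edge" if "wedge N d" 
      using that * BN wt_less_add_small[OF N p, of d] by (auto simp: edge_def)
  qed (auto simp: finD k)
  have "norm (\<Sum>x\<in>int_box B. disc N (x - p) * ?g x) \<le> ?K * (hs B ^ 2 / N^2) +
     ((1 / c) ^ k * hs B ^ 2 / N^2 + 120 * (1 / c) ^ k / N^2) + 120 * (1 / c) ^ k / N^2"
    unfolding eq by (intro norm_triangle_mono norm_triangle_le_diff add_mono n1 n3 n4 sum_disc_0 k)
  \<comment> \<open>Since \<open>hs B\<close> and \<open>wt p\<close> are at least 1, every term can
    be brought to the common shape.\<close>
  also have "\<dots> \<le> ?K * (hs B ^ 2 / N^2) +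
     ((1 / c) ^ k * hs B ^ 2 / N^2 * wt p + 120 * (1 / c) ^ k * hs B ^ 2 / N^2 * wt p) + 120 * (1 / c) ^ k * hs B ^ 2 / N^2 * wt p"
  proof -
    have h: "1 \<le> hs B ^ 2" using hs_ge_1[OF B_ge(3)] by simp
    have "1 * 1 \<le> hs B ^ 2 * wt p" using h by (intro mult_mono) auto
    then have a: "120 * (1 / c) ^ k / N^2 * 1 \<le> 120 * (1 / c) ^ k / N^2 * (hs B ^ 2 * wt p)"
      using c by (intro mult_left_mono) auto
    have b: "(1 / c) ^ k * hs B ^ 2 / N^2 * 1 \<le> (1 / c) ^ k * hs B ^ 2 / N^2 * wt p"
      using c by (intro mult_left_mono) auto
    show ?thesis using add_mono[OF add_mono[OF b a] a] by (simp add: mult_ac)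
  qed
  also have "\<dots> = KT k * hs B ^ 2 / N^2 * wt p"
    by (simp add: KT_def algebra_simps add_divide_distrib)
  finally show ?thesis .
qed

end

section \<open>Inserting one large point into a chain of small points\<close>

lemma chain_strip_le:
  assumes "cone_chain pos0 r P" "P r = 0" "i \<le> r"
  shows "strip (P 0) (P i)"
proof (cases "i = r")
  case True
  then have "r = 0 \<or> pos0 (P 0 - P r)"
    using chain_less[of pos0 r P 0 r] pos0_add assms by auto
  then show ?thesis using True assms by (auto simp: strip_def pos0_def)
qed (use chain_strip assms in auto)

text \<open>Deleting the entry \<open>j\<close> leaves a chain with \<open>r - 1\<close> members, to
  which the confinement to the strip applies; the old index \<open>Suc j\<close> becomes
  \<open>j\<close>.\<close>

lemma chain_skip_strip:
  assumes j: "0 < j" "j < r" and "P r = 0"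
    and "\<And>i. i < r \<Longrightarrow> i \<noteq> j \<Longrightarrow> i \<noteq> j - 1 \<Longrightarrow> pos0 (P i - P (Suc i))"
    and "pos0 (P (j - 1) - P (Suc j))"
  shows "strip (P 0) (P (j - 1))" "strip (P 0) (P (Suc j))"
proof -
  define P' where "P' i = P (if i < j then i else Suc i)" for i
  have "cone_chain pos0 (r - 1) P'"
    unfolding cone_chain_def
  proof (intro allI impI)
    fix i assume "i < r - 1"
    then show "pos0 (P' i - P' (Suc i))"
      using assms(4)[of i] assms(4)[of "Suc i"] assms(5) j
      by (cases "i < j - 1"; cases "i = j - 1") (auto simp: P'_def)
  qed
  moreover have "P' (r - 1) = 0" using assms by (auto simp: P'_def)
  ultimately have "strip (P' 0) (P' i)" if "i \<le> r - 1" for i using chain_strip_le that by blast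
  from this[of "j - 1"] this[of j] show "strip (P 0) (P (j - 1))" "strip (P 0) (P (Suc j))"
    using j by (auto simp: P'_def)
qed

text \<open>At least one of the two relations holds: otherwise totality gives b > x > a, against a >
  b.\<close>

lemma of_bool_between:
  fixes a b x :: "'a::ab_group_add"
  assumes "\<And>d. d \<noteq> 0 \<Longrightarrow> R (- d) \<longleftrightarrow> \<not> R d" and "\<And>d e. R d \<Longrightarrow> R e \<Longrightarrow> R (d + e)"
    and "R (a - b)" "x \<noteq> a" "x \<noteq> b" "\<not> R 0"
  shows "(of_bool (R (a - x) \<and> R (x - b)) :: complex) = of_bool (R (a - x)) + of_bool (R (x - b)) - 1"
proof -
  have "R (a - x) \<or> R (x - b)"
  proof (rule ccontr)
    assume "\<not> ?thesis"
    then have "R (x - a)" "R (b - x)"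
      using assms(1)[of "a - x"] assms(1)[of "x - b"] assms(4,5) by auto
    then have "R ((b - x) + (x - a))" by (intro assms(2)) auto
    then have R: "R (b - a)" by simp
    have "R ((a - b) + (b - a))" by (intro assms(2) assms(3) R)
    then show False using assms(6) by simp
  qed
  then show ?thesis by auto
qed

context lattice_box
begin

lemma small_pos_eq:
  assumes "small N p" "small N q"
  shows "posN N (p - q) = pos0 (p - q)"
proof (rule ccontr)
  assume "\<not> ?thesis"
  then have "wedge N (p - q)" using pos_eq_or_wedge by blast
  then show False using wedge_steep_at[OF N _ assms(2)] steep_at_not_small[OF N] assms(1) by blast
qed

lemma chain_update:
  assumes "0 < j" "j < r"
  shows "cone_chain R r (P(j := x)) \<longleftrightarrow> 
     (\<forall>i<r. i \<noteq> j \<longrightarrow> i \<noteq> j - 1 \<longrightarrow> R (P i - P (Suc i))) \<and> R (P (j - 1) - x) \<and> R (x - P (Suc j))"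
proof -
  have "R ((P(j := x)) i - (P(j := x)) (Suc i)) \<longleftrightarrow> 
     (if i = j then R (x - P (Suc j)) else if i = j - 1 then R (P (j - 1) - x) else R (P i - P (Suc i)))" for i
    using assms by (auto simp: fun_upd_def)
  then show ?thesis unfolding cone_chain_def using assms
    by (auto simp: fun_upd_def split: if_splits)
qed

text \<open>The chain condition for the points other than \<open>P j\<close>. It is stated for
  \<open>pos0\<close> only, since both orders agree on these points when they are small.\<close>

definition skip :: "nat \<Rightarrow> nat \<Rightarrow> (nat \<Rightarrow> int \<times> int) \<Rightarrow> bool" where
  "skip r j P \<longleftrightarrow> (\<forall>i<r. i \<noteq> j \<longrightarrow> i \<noteq> j - 1 \<longrightarrow> pos0 (P i - P (Suc i))) \<and> pos0 (P (j - 1) - P (Suc j))"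

definition gap :: "nat \<Rightarrow> (nat \<Rightarrow> int \<times> int) \<Rightarrow> complex" where
  "gap r P = of_bool (cone_chain (posN N) r P) - of_bool (cone_chain pos0 r P)"

text \<open>With all other points small, only the two comparisons with \<open>x\<close> can
  distinguish the orders. If the neighbours of \<open>x\<close> are in the wrong order, transitivity
  leaves no room for \<open>x\<close> in either chain.\<close>

lemma gap_update:
  assumes j: "0 < j" "j < r" and "\<And>i. i \<le> r \<Longrightarrow> i \<noteq> j \<Longrightarrow> small N (P i)" "\<not> small N x"
  shows "gap r (P(j := x)) = of_bool (skip r j P) * (disc N (x - P (Suc j)) - disc N (x - P (j - 1)))"
proof -
  let ?a = "P (j - 1)" and ?b = "P (Suc j)"
  have eq: "(\<forall>i<r. i \<noteq> j \<longrightarrow> i \<noteq> j - 1 \<longrightarrow> posN N (P i - P (Suc i))) \<longleftrightarrow>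
            (\<forall>i<r. i \<noteq> j \<longrightarrow> i \<noteq> j - 1 \<longrightarrow> pos0 (P i - P (Suc i)))"
  proof (intro all_cong imp_cong refl)
    fix i assume "i < r" "i \<noteq> j" "i \<noteq> j - 1"
    then have "small N (P i)" "small N (P (Suc i))" using assms(3)[of i] assms(3)[of "Suc i"] by auto
    then show "posN N (P i - P (Suc i)) = pos0 (P i - P (Suc i))" by (rule small_pos_eq)
  qed
  have sm: "small N ?a" "small N ?b" using j by (auto intro!: assms(3))
  have ne: "x \<noteq> ?a" "x \<noteq> ?b" using sm assms(4) by auto
  define X where "X \<longleftrightarrow> (\<forall>i<r. i \<noteq> j \<longrightarrow> i \<noteq> j - 1 \<longrightarrow> pos0 (P i - P (Suc i)))"
  have chN: "cone_chain (posN N) r (P(j := x)) \<longleftrightarrow> X \<and> posN N (?a - x) \<and> posN N (x - ?b)"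
    and ch0: "cone_chain pos0 r (P(j := x)) \<longleftrightarrow> X \<and> pos0 (?a - x) \<and> pos0 (x - ?b)"
    and sk: "skip r j P \<longleftrightarrow> X \<and> pos0 (?a - ?b)"
    unfolding chain_update[OF j] skip_def eq X_def by (rule refl)+
  show ?thesis
  proof (cases "pos0 (?a - ?b)")
    case True
    then have "posN N (?a - ?b)" using small_pos_eq sm by simp
    then have "of_bool (posN N (?a - x) \<and> posN N (x - ?b)) - of_bool (pos0 (?a - x) \<and> pos0 (x - ?b))
        = disc N (?a - x) + disc N (x - ?b)"
      using of_bool_between[of "posN N" ?a ?b x] of_bool_between[of pos0 ?a ?b x] True ne
        pos0_total posN_total pos0_add posN_add by (simp add: disc_def)
    also have "\<dots> = disc N (x - ?b) - disc N (x - ?a)"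
      using disc_minus_commute[of N ?a x] by (simp only: uminus_add_conv_diff)
    finally have "of_bool (posN N (?a - x) \<and> posN N (x - ?b)) - of_bool (pos0 (?a - x) \<and> pos0 (x - ?b))
        = disc N (x - ?b) - disc N (x - ?a)" .
    then show ?thesis unfolding gap_def chN ch0 sk
      using True by (cases X) (simp_all only: simp_thms of_bool_eq mult_1 mult_zero_left diff_self)
  next
    case False
    then have nN: "\<not> posN N (?a - ?b)" using small_pos_eq sm by simp
    have "\<not> (pos0 (?a - x) \<and> pos0 (x - ?b))"
      using False pos0_add[of "?a - x" "x - ?b"] by auto
    moreover have "\<not> (posN N (?a - x) \<and> posN N (x - ?b))"
      using nN posN_add[of N "?a - x" "x - ?b"] by auto
    ultimately show ?thesis unfolding gap_def chN ch0 sk using False by auto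
  qed
qed

text \<open>Restricting to large \<open>x\<close> changes nothing, because \<open>disc\<close>
  vanishes between small points. So the symmetric sum over the whole box is available although a
  lone point must be large.\<close>

lemma sum_disc_not_small:
  assumes "small N p" "k \<ge> 2"
  shows "norm (\<Sum>x\<in>int_box B. of_bool (\<not> small N x) * (disc N (x - p) * (1 / lam \<tau> x ^ k))) \<le> KT k * hs B ^ 2 / N^2 * wt p"
proof -
  have "of_bool (\<not> small N x) * (disc N (x - p) * (1 / lam \<tau> x ^ k)) = disc N (x - p) * (1 / lam \<tau> x ^ k)" for x
  proof (cases "small N x")
    case True
    then have "disc N (x - p) = 0" using assms(1) small_pos_eq by (simp add: disc_def)
    then show ?thesis by simp
  qed auto
  then show ?thesis using sum_disc_small[OF assms] by (simp only:)
qed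

end

section \<open>The difference of the two chain sums inside the box\<close>

locale lattice_weights = lattice_box +
  fixes r :: nat and k :: "nat \<Rightarrow> nat"
  assumes r: "r \<ge> 1" and k0: "k 0 \<ge> 3" and k2: "\<And>i. 1 \<le> i \<Longrightarrow> i < r \<Longrightarrow> k i \<ge> 2"
begin

definition summand :: "nat set \<Rightarrow> (nat \<Rightarrow> int \<times> int) \<Rightarrow> complex" where
  "summand J P = (\<Prod>i\<in>J. 1 / lam \<tau> (P i) ^ k i)"

definition CK :: real where "CK = (\<Prod>i<r. (1 / c) ^ k i)"

lemma CK_ge_1: "CK \<ge> 1"
  unfolding CK_def using c by (intro prod_ge_1) auto

text \<open>As 1 / \<open>c\<close> is at least 1, adding the factors of the missing indices only
  enlarges the constant, so one \<open>CK\<close> serves all \<open>J\<close>.\<close>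

lemma norm_tm_le:
  assumes "J \<subseteq> {..<r}"
  shows "norm (summand J P) \<le> CK * (\<Prod>i\<in>J. uw i (P i))"
proof -
  have fin: "finite J" using assms finite_subset by blast
  have "norm (summand J P) \<le> (\<Prod>i\<in>J. (1 / c) ^ k i * uw i (P i))"
    unfolding summand_def prod_norm [symmetric]
  proof (intro prod_mono conjI)
    fix i assume "i \<in> J"
    then show "norm (1 / lam \<tau> (P i) ^ k i) \<le> (1 / c) ^ k i * uw i (P i)"
      using assms k0 k2[of i] norm_term_le[of 3 "k i" "P i"] norm_term_le[of 2 "k i" "P i"]
      by (cases "i = 0") (auto simp: uw_def)
  qed auto
  also have "\<dots> = (\<Prod>i\<in>J. (1 / c) ^ k i) * (\<Prod>i\<in>J. uw i (P i))" by (rule prod.distrib)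
  also have "\<dots> \<le> CK * (\<Prod>i\<in>J. uw i (P i))"
  proof (intro mult_right_mono prod_nonneg)
    have "(\<Prod>i\<in>J. (1 / c) ^ k i) * 1 \<le> (\<Prod>i\<in>J. (1 / c) ^ k i) * (\<Prod>i\<in>{..<r} - J. (1 / c) ^ k i)"
      using c by (intro mult_left_mono prod_ge_1 prod_nonneg) auto
    also have "\<dots> = CK" unfolding CK_def using prod.subset_diff[OF assms, of "\<lambda>i. (1 / c) ^ k i"] by (simp add: mult.commute)
    finally show "(\<Prod>i\<in>J. (1 / c) ^ k i) \<le> CK" by simp
  qed auto
  finally show ?thesis .
qed

end

context lattice_weights
begin

text \<open>The sum over the lone coordinate is done first and without absolute values; only its
  result, bounded by the weights of the two neighbours, is then summed over the rest. Each neighbour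
  contributes 2, hence the 4.\<close>

lemma sum_lone:
  assumes j: "j \<in> {1..<r}"
  shows "norm (\<Sum>P\<in>tuples {..<r} (int_box B). of_bool (lone N r j P) * (summand {..<r} P * gap r P))
     \<le> 4 * CK * KT (k j) * hs B ^ (2 * r + 2) / N^2"
proof -
  define J where "J = {..<r} - {j}"
  have J: "{..<r} = insert j J" "j \<notin> J" "finite J" using j by (auto simp: J_def)
  let ?T = "tuples J (int_box B)" and ?t = "\<lambda>x. 1 / lam \<tau> x ^ k j"
  let ?K = "KT (k j) * hs B ^ 2 / N^2"
  let ?w = "\<lambda>l P. wt (P l) * of_bool (strip (P 0) (P l))"
  have K: "?K \<ge> 0" using KT_nonneg by simp
  have in1: "norm (\<Sum>x\<in>int_box B. of_bool (lone N r j (P(j := x))) * (summand {..<r} (P(j := x)) * gap r (P(j := x))))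
      \<le> CK * (\<Prod>i\<in>J. uw i (P i)) * (?K * (?w (j - 1) P + ?w (Suc j) P))" if P: "P \<in> ?T" for P
  \<comment> \<open>This condition does not involve \<open>x\<close>; where it fails, every term of
    the inner sum is 0.\<close>
  proof (cases "(\<forall>i\<in>J. small N (P i)) \<and> skip r j P")
    case True
    have Pr: "P r = 0" using P j by (auto simp: tuples_def J_def)
    have sm: "small N (P i)" if "i \<le> r" "i \<noteq> j" for i
      using that True Pr N by (cases "i = r") (auto simp: J_def)
    have st: "strip (P 0) (P (j - 1))" "strip (P 0) (P (Suc j))"
      using chain_skip_strip[of j r P] True Pr j by (auto simp: skip_def)
    have "of_bool (lone N r j (P(j := x))) * (summand {..<r} (P(j := x)) * gap r (P(j := x)))
       = summand J P * (of_bool (\<not> small N x) * (disc N (x - P (Suc j)) * ?t x) -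
                   of_bool (\<not> small N x) * (disc N (x - P (j - 1)) * ?t x))" for x
    proof (cases "small N x")
      case False
      have 1: "lone N r j (P(j := x))" using False sm by (auto simp: lone_def)
      have 2: "summand {..<r} (P(j := x)) = ?t x * summand J P"
        unfolding summand_def J(1) using J by (intro prod_update_insert[where u = "\<lambda>i y. 1 / lam \<tau> y ^ k i"]) auto
      have 3: "gap r (P(j := x)) = disc N (x - P (Suc j)) - disc N (x - P (j - 1))"
        using gap_update[of j r P x] j False sm True by auto
      show ?thesis unfolding 2 3 using 1 False by (simp add: algebra_simps)
    qed (auto simp: lone_def)
    then have "(\<Sum>x\<in>int_box B. of_bool (lone N r j (P(j := x))) * (summand {..<r} (P(j := x)) * gap r (P(j := x))))
       = summand J P * ((\<Sum>x\<in>int_box B. of_bool (\<not> small N x) * (disc N (x - P (Suc j)) * ?t x)) -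
                   (\<Sum>x\<in>int_box B. of_bool (\<not> small N x) * (disc N (x - P (j - 1)) * ?t x)))"
      by (simp only: sum_subtractf sum_distrib_left [symmetric])
    then have "norm (\<Sum>x\<in>int_box B. of_bool (lone N r j (P(j := x))) * (summand {..<r} (P(j := x)) * gap r (P(j := x))))
       = norm (summand J P) * norm ((\<Sum>x\<in>int_box B. of_bool (\<not> small N x) * (disc N (x - P (Suc j)) * ?t x)) -
                   (\<Sum>x\<in>int_box B. of_bool (\<not> small N x) * (disc N (x - P (j - 1)) * ?t x)))"
      by (simp only: norm_mult)
    also have "\<dots> \<le> (CK * (\<Prod>i\<in>J. uw i (P i))) * (?K * wt (P (Suc j)) + ?K * wt (P (j - 1)))"
    proof (intro mult_mono norm_tm_le order.trans[OF norm_triangle_ineq4 add_mono])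
      have kj: "k j \<ge> 2" using k2 j by simp
      show "norm (\<Sum>x\<in>int_box B. of_bool (\<not> small N x) * (disc N (x - P (Suc j)) * ?t x)) \<le> ?K * wt (P (Suc j))"
        by (rule sum_disc_not_small[OF _ kj]) (use sm j in auto)
      show "norm (\<Sum>x\<in>int_box B. of_bool (\<not> small N x) * (disc N (x - P (j - 1)) * ?t x)) \<le> ?K * wt (P (j - 1))"
        by (rule sum_disc_not_small[OF _ kj]) (use sm j in auto)
      show "0 \<le> CK * (\<Prod>i\<in>J. uw i (P i))"
        using CK_ge_1 by (intro mult_nonneg_nonneg prod_nonneg) auto
    qed (auto simp: J_def)
    also have "\<dots> = CK * (\<Prod>i\<in>J. uw i (P i)) * (?K * (?w (j - 1) P + ?w (Suc j) P))"
      using st by (simp add: algebra_simps add_divide_distrib)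
    finally show ?thesis .
  next
    case False
    have "of_bool (lone N r j (P(j := x))) * (summand {..<r} (P(j := x)) * gap r (P(j := x))) = 0" for x
    proof (cases "lone N r j (P(j := x))")
      case True
      have Pr: "P r = 0" using P j by (auto simp: tuples_def J_def)
      have sm: "small N (P i)" if "i \<le> r" "i \<noteq> j" for i
        using that True Pr N by (cases "i = r") (auto simp: lone_def)
      then have "\<not> skip r j P" using False by (auto simp: J_def)
      then show ?thesis using gap_update[of j r P x] sm j True by (auto simp: lone_def)
    qed auto
    then have "(\<Sum>x\<in>int_box B. of_bool (lone N r j (P(j := x))) * (summand {..<r} (P(j := x)) * gap r (P(j := x)))) = 0"
      by (intro sum.neutral) auto
    then show ?thesis using K CK_ge_1
      by (simp only: norm_zero) (intro mult_nonneg_nonneg add_nonneg_nonneg prod_nonneg, auto)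
  qed
  have "(\<Sum>P\<in>tuples {..<r} (int_box B). of_bool (lone N r j P) * (summand {..<r} P * gap r P)) =
     (\<Sum>P\<in>?T. \<Sum>x\<in>int_box B. of_bool (lone N r j (P(j := x))) * (summand {..<r} (P(j := x)) * gap r (P(j := x))))"
    using sum_tuples_insert[OF J(2), where Q = "int_box B" and G = "\<lambda>P. of_bool (lone N r j P) * (summand {..<r} P * gap r P)"] 
    unfolding J(1)[symmetric] .
  then have "norm (\<Sum>P\<in>tuples {..<r} (int_box B). of_bool (lone N r j P) * (summand {..<r} P * gap r P)) 
    \<le> (\<Sum>P\<in>?T. norm (\<Sum>x\<in>int_box B. of_bool (lone N r j (P(j := x))) * (summand {..<r} (P(j := x)) * gap r (P(j := x)))))"
    by (simp only:) (rule norm_sum)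
  also have "\<dots> \<le> (\<Sum>P\<in>?T. CK * (\<Prod>i\<in>J. uw i (P i)) * (?K * (?w (j - 1) P + ?w (Suc j) P)))"
    by (intro sum_mono in1)
  also have "\<dots> = CK * ?K * ((\<Sum>P\<in>?T. (\<Prod>i\<in>J. uw i (P i)) * ?w (j - 1) P) + (\<Sum>P\<in>?T. (\<Prod>i\<in>J. uw i (P i)) * ?w (Suc j) P))"
    unfolding sum.distrib [symmetric] sum_distrib_left by (intro sum.cong refl) (simp add: algebra_simps)
  also have "\<dots> \<le> CK * ?K * (2 * hs B ^ (2 * r) + 2 * hs B ^ (2 * r))"
    unfolding J_def using j CK_ge_1 K
    by (intro mult_left_mono add_mono sum_tuples_strip[OF N B_ge(3)] mult_nonneg_nonneg) auto
  also have "\<dots> = 4 * CK * KT (k j) * hs B ^ (2 * r + 2) / N^2"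
    by (simp add: power_add power2_eq_square)
  finally show ?thesis .
qed

lemma lone_unique:
  assumes "lone N r i P" "lone N r j P" "i < r"
  shows "i = j"
proof (rule ccontr)
  assume "i \<noteq> j"
  then have "i \<in> {..<r} - {j}" using assms(3) by simp
  then have "small N (P i)" using assms(2) unfolding lone_def by blast
  then show False using assms(1) by (simp add: lone_def)
qed

lemma norm_gap_le: "norm (gap r P) \<le> 1"
  by (simp add: gap_def)

definition CB :: real where
  "CB = CK * (4 * (\<Sum>j\<in>{1..<r}. KT (k j)) + real (4 + r * (r + 1) * 8 + r * (r + 1) * r * 24))"

lemma sum_box_gap:
  "norm (\<Sum>P\<in>tuples {..<r} (int_box B). summand {..<r} P * gap r P) \<le> CB * hs B ^ (2 * r + 2) / N^2"
proof -
  let ?T = "tuples {..<r} (int_box B)" and ?f = "\<lambda>P. summand {..<r} P * gap r P"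
  let ?M = "real (4 + r * (r + 1) * 8 + r * (r + 1) * r * 24)"
  \<comment> \<open>At most one index can be lone, so the indicators of the lone cases and of their
    complement partition the tuples.\<close>
  have split: "?f P = (\<Sum>j\<in>{1..<r}. of_bool (lone N r j P) * ?f P) 
       + of_bool (\<not> (\<exists>j\<in>{1..<r}. lone N r j P)) * ?f P" for P
  proof (cases "\<exists>j\<in>{1..<r}. lone N r j P")
    case True
    then obtain j where j: "j \<in> {1..<r}" "lone N r j P" by blast
    have other: "\<not> lone N r i P" if "i \<in> {1..<r} - {j}" for i
      using lone_unique[of i P j] j that by auto
    have "(\<Sum>i\<in>{1..<r}. of_bool (lone N r i P) * ?f P) = of_bool (lone N r j P) * ?f P"
      by (subst sum.remove[OF _ j(1)], simp, subst sum.neutral) (use other in simp_all)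
    then show ?thesis using j by (simp only: True not_True_eq_False of_bool_eq mult_1 mult_zero_left add_0_right)
  next
    case False
    then have "(\<Sum>j\<in>{1..<r}. of_bool (lone N r j P) * ?f P) = 0" by (intro sum.neutral) simp
    then show ?thesis by (simp only: False not_False_eq_True of_bool_eq mult_1 add_0_left)
  qed
  let ?S = "\<Sum>j\<in>{1..<r}. \<Sum>P\<in>?T. of_bool (lone N r j P) * ?f P"
  let ?R = "\<Sum>P\<in>?T. of_bool (\<not> (\<exists>j\<in>{1..<r}. lone N r j P)) * ?f P"
  have swap: "(\<Sum>P\<in>?T. \<Sum>j\<in>{1..<r}. of_bool (lone N r j P) * ?f P) = ?S" by (rule sum.swap)
  have "(\<Sum>P\<in>?T. ?f P) = (\<Sum>P\<in>?T. (\<Sum>j\<in>{1..<r}. of_bool (lone N r j P) * ?f P)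
       + of_bool (\<not> (\<exists>j\<in>{1..<r}. lone N r j P)) * ?f P)"
    by (rule sum.cong[OF refl split])
  then have eq: "(\<Sum>P\<in>?T. ?f P) = ?S + ?R" unfolding sum.distrib swap .
  have "norm (\<Sum>P\<in>?T. ?f P) \<le> (\<Sum>j\<in>{1..<r}. 4 * CK * KT (k j) * hs B ^ (2 * r + 2) / N^2)
       + CK * (?M * hs B ^ (2 * r) / N^2)"
    unfolding eq
  proof (rule norm_triangle_mono)
    show "norm (\<Sum>j\<in>{1..<r}. \<Sum>P\<in>?T. of_bool (lone N r j P) * ?f P)
       \<le> (\<Sum>j\<in>{1..<r}. 4 * CK * KT (k j) * hs B ^ (2 * r + 2) / N^2)"
      by (rule order.trans[OF norm_sum], rule sum_mono, rule sum_lone)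
    have "norm (\<Sum>P\<in>?T. of_bool (\<not> (\<exists>j\<in>{1..<r}. lone N r j P)) * ?f P)
       \<le> (\<Sum>P\<in>?T. norm (of_bool (\<not> (\<exists>j\<in>{1..<r}. lone N r j P)) * ?f P))" by (rule norm_sum)
    also have "\<dots> \<le> (\<Sum>P\<in>?T. CK * ((\<Prod>i<r. uw i (P i)) * of_bool (bad N r P)))"
    proof (rule sum_mono)
      fix P assume P: "P \<in> ?T"
      have b: "norm (summand {..<r} P) * norm (gap r P) \<le> CK * (\<Prod>i<r. uw i (P i)) * 1"
        using CK_ge_1 by (intro mult_mono norm_tm_le norm_gap_le mult_nonneg_nonneg prod_nonneg) auto
      show "norm (of_bool (\<not> (\<exists>j\<in>{1..<r}. lone N r j P)) * ?f P) \<le> CK * ((\<Prod>i<r. uw i (P i)) * of_bool (bad N r P))"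
      proof (cases "bad N r P")
        case True
        have "norm (of_bool (\<not> (\<exists>j\<in>{1..<r}. lone N r j P)) * ?f P) \<le> norm (?f P)"
          by (simp add: of_bool_def)
        also have "\<dots> \<le> CK * (\<Prod>i<r. uw i (P i)) * 1" using b by (simp only: norm_mult)
        finally show ?thesis using True by simp
      next
        case False
        have "P r = 0" using P by (auto simp: tuples_def)
        then have "(\<exists>j\<in>{1..<r}. lone N r j P) \<or> gap r P = 0"
          using discrepancy_cases[OF N, of r P] False by (auto simp: gap_def)
        then have "of_bool (\<not> (\<exists>j\<in>{1..<r}. lone N r j P)) * ?f P = 0"
          by (elim disjE) (simp_all only: simp_thms of_bool_eq mult_zero_left mult_zero_right)
        then show ?thesis using CK_ge_1
          by (simp only: norm_zero) (intro mult_nonneg_nonneg prod_nonneg, auto)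
      qed
    qed
    also have "\<dots> \<le> CK * (?M * hs B ^ (2 * r) / N^2)"
      unfolding sum_distrib_left [symmetric] using CK_ge_1
      by (intro mult_left_mono sum_tuples_bad[OF N B_ge(3) r]) auto
    finally show "norm (\<Sum>P\<in>?T. of_bool (\<not> (\<exists>j\<in>{1..<r}. lone N r j P)) * ?f P)
       \<le> CK * (?M * hs B ^ (2 * r) / N^2)" .
  qed
  also have "\<dots> \<le> (\<Sum>j\<in>{1..<r}. 4 * CK * KT (k j) * hs B ^ (2 * r + 2) / N^2)
       + CK * (?M * hs B ^ (2 * r + 2) / N^2)"
    using CK_ge_1
    by (intro add_left_mono mult_left_mono divide_right_mono hs_power_mono[OF N B_ge(3)]) auto
  also have "(\<Sum>j\<in>{1..<r}. 4 * CK * KT (k j) * hs B ^ (2 * r + 2) / N^2) = 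
      CK * (4 * (\<Sum>j\<in>{1..<r}. KT (k j))) * hs B ^ (2 * r + 2) / N^2"
    by (simp add: sum_distrib_left sum_distrib_right sum_divide_distrib mult_ac)
  also have "CK * (4 * (\<Sum>j\<in>{1..<r}. KT (k j))) * hs B ^ (2 * r + 2) / N^2 + CK * (?M * hs B ^ (2 * r + 2) / N^2)
     = CB * hs B ^ (2 * r + 2) / N^2"
    unfolding CB_def by (simp only: distrib_left distrib_right add_divide_distrib times_divide_eq_right mult.assoc)
  finally show ?thesis .
qed

end

section \<open>Truncation to a box\<close>

lemma sum_mx_powr_bounded:
  assumes "\<theta> > 0"
  shows "\<exists>Z\<ge>1. \<forall>M. finite M \<longrightarrow> (\<Sum>m\<in>M. mx m powr (-1 - \<theta>)) \<le> Z"
proof -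
  define g where "g n = max 1 (real n) powr (-1 - \<theta>)" for n :: nat
  have s: "summable (\<lambda>n. real n powr (-1 - \<theta>))" using assms by (subst summable_real_powr_iff) auto
  have "eventually (\<lambda>n. real n powr (-1 - \<theta>) = g n) sequentially"
    using eventually_ge_at_top[of 1] by eventually_elim (auto simp: g_def max_def)
  from summable_cong[OF this] s have sg: "summable g" by simp
  have half: "(\<Sum>m\<in>M. mx m powr (-1 - \<theta>)) \<le> suminf g" if "finite M" "inj_on (\<lambda>m. nat \<bar>m\<bar>) M" for M
  proof -
    have "(\<Sum>m\<in>M. mx m powr (-1 - \<theta>)) = (\<Sum>n\<in>(\<lambda>m. nat \<bar>m\<bar>) ` M. g n)"
      by (subst sum.reindex[OF that(2)]) (auto simp: g_def mx_def)
    also have "\<dots> \<le> suminf g" using that by (intro sum_le_suminf sg) (auto simp: g_def)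
    finally show ?thesis .
  qed
  have "(\<Sum>m\<in>M. mx m powr (-1 - \<theta>)) \<le> 2 * suminf g + 1" if "finite M" for M
  proof -
    have "(\<Sum>m\<in>M. mx m powr (-1 - \<theta>)) = (\<Sum>m\<in>M \<inter> {0..}. mx m powr (-1 - \<theta>)) + (\<Sum>m\<in>M - {0..}. mx m powr (-1 - \<theta>))"
      using that by (rule sum.Int_Diff)
    also have "\<dots> \<le> suminf g + suminf g"
      using that by (intro add_mono half) (auto simp: inj_on_def)
    finally show ?thesis by simp
  qed
  moreover have "0 \<le> suminf g" using sg by (intro suminf_nonneg) (auto simp: g_def)
  ultimately show ?thesis by (intro exI[of _ "2 * suminf g + 1"]) auto
qed

lemma sum_pair_le:
  fixes f g :: "int \<Rightarrow> real"
  assumes "finite Q" "inj_on (\<lambda>x. (key x, oth x)) Q"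
    and "\<And>M. finite M \<Longrightarrow> (\<Sum>m\<in>M. f m) \<le> Z" "\<And>m. f m \<ge> 0"
  shows "(\<Sum>x\<in>Q. f (key x) * f (oth x)) \<le> Z ^ 2"
proof -
  have "(\<Sum>x\<in>Q. f (key x) * f (oth x)) = (\<Sum>(m, n)\<in>(\<lambda>x. (key x, oth x)) ` Q. f m * f n)"
    by (subst sum.reindex[OF assms(2)]) simp
  also have "\<dots> \<le> (\<Sum>(m, n)\<in>key ` Q \<times> oth ` Q. f m * f n)"
    using assms by (intro sum_mono2) auto
  also have "\<dots> = (\<Sum>m\<in>key ` Q. f m) * (\<Sum>n\<in>oth ` Q. f n)"
    by (simp add: sum_product sum.cartesian_product)
  also have "\<dots> \<le> Z * Z"
    using assms by (intro mult_mono assms(3) sum_nonneg order.trans[OF sum_nonneg assms(3)]) auto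
  finally show ?thesis by (simp add: power2_eq_square)
qed

text \<open>
  \<open>key\<close> is the leading coordinate of the lexicographic order (\<open>fst\<close> or the height), so that all
  members of a chain have \<open>key\<close> between \<open>0\<close> and that of the first member.
\<close>

locale strip_sum =
  fixes key oth :: "int \<times> int \<Rightarrow> int" and G \<theta> Z :: real
  assumes inj: "inj (\<lambda>x. (key x, oth x))"
    and G: "G \<ge> 1" and key_le: "\<And>x. mx (key x) \<le> G * wt x" and oth_le: "\<And>x. mx (oth x) \<le> G * wt x"
    and \<theta>: "0 < \<theta>" "\<theta> \<le> 1 / 3"
    and Z: "Z \<ge> 1" "\<And>M. finite M \<Longrightarrow> (\<Sum>m\<in>M. mx m powr (-1 - \<theta>)) \<le> Z"
begin

text \<open>The exponent is shared as (-1 - \<theta>) + (-1 + 2 \<theta>) between \<open>oth\<close>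
  and \<open>key\<close>. The deficit 3 \<theta> in the \<open>key\<close> part is bounded through
  \<open>key q\<close>, and both coordinates keep the summable exponent -1 - \<theta>. The powers of
  \<open>G\<close> add up to 2 + 2 \<theta>, at most 3.\<close>

lemma sum_strip_powr:
  assumes "finite Q"
  shows "(\<Sum>x\<in>Q. wt x powr (-2 + \<theta>) * of_bool (0 \<le> key x \<and> key x \<le> key q)) \<le> G ^ 3 * Z ^ 2 * wt q powr (3 * \<theta>)"
proof -
  have "wt x powr (-2 + \<theta>) * of_bool (0 \<le> key x \<and> key x \<le> key q)
     \<le> (G ^ 3 * wt q powr (3 * \<theta>)) * (mx (key x) powr (-1 - \<theta>) * mx (oth x) powr (-1 - \<theta>))" for x
  proof (cases "0 \<le> key x \<and> key x \<le> key q")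
    case True
    have G0: "G > 0" using G by linarith
    have le: "mx (oth x) / G \<le> wt x" "mx (key x) / G \<le> wt x"
      using key_le[of x] oth_le[of x] G0 by (auto simp: field_simps)
    have "mx (key x) \<le> mx (key q)" using True unfolding mx_def by linarith
    then have kq: "mx (key x) \<le> G * wt q" using key_le[of q] by linarith
    have "wt x powr (-2 + \<theta>) = wt x powr (-1 - \<theta>) * wt x powr (-1 + 2 * \<theta>)"
      by (simp add: powr_add [symmetric])
    also have "\<dots> \<le> (mx (oth x) / G) powr (-1 - \<theta>) * (mx (key x) / G) powr (-1 + 2 * \<theta>)"
      using \<theta> G0 le by (intro mult_mono powr_mono2') auto
    also have "\<dots> = mx (oth x) powr (-1 - \<theta>) * mx (key x) powr (-1 + 2 * \<theta>) * (G powr (1 + \<theta>) * G powr (1 - 2 * \<theta>))"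
      using G0 by (simp add: powr_divide divide_powr_uminus add.commute)
    also have "mx (key x) powr (-1 + 2 * \<theta>) = mx (key x) powr (-1 - \<theta>) * mx (key x) powr (3 * \<theta>)"
      by (simp add: powr_add [symmetric])
    also have "mx (oth x) powr (-1 - \<theta>) * (mx (key x) powr (-1 - \<theta>) * mx (key x) powr (3 * \<theta>)) * (G powr (1 + \<theta>) * G powr (1 - 2 * \<theta>))
       \<le> mx (oth x) powr (-1 - \<theta>) * (mx (key x) powr (-1 - \<theta>) * (G * wt q) powr (3 * \<theta>)) * (G powr (1 + \<theta>) * G powr (1 - 2 * \<theta>))"
      using kq \<theta> by (intro mult_right_mono mult_left_mono powr_mono2) auto
    also have "\<dots> = (G powr (3 * \<theta>) * (G powr (1 + \<theta>) * G powr (1 - 2 * \<theta>))) * wt q powr (3 * \<theta>) * (mx (key x) powr (-1 - \<theta>) * mx (oth x) powr (-1 - \<theta>))"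
      using G0 by (simp add: powr_mult mult_ac)
    also have "G powr (3 * \<theta>) * (G powr (1 + \<theta>) * G powr (1 - 2 * \<theta>)) = G powr (2 + 2 * \<theta>)"
      by (simp add: powr_add [symmetric] add.commute)
    also have "\<dots> * wt q powr (3 * \<theta>) * (mx (key x) powr (-1 - \<theta>) * mx (oth x) powr (-1 - \<theta>)) \<le>
       G ^ 3 * wt q powr (3 * \<theta>) * (mx (key x) powr (-1 - \<theta>) * mx (oth x) powr (-1 - \<theta>))"
    proof (intro mult_right_mono)
      have "G powr (2 + 2 * \<theta>) \<le> G powr (real 3)" using G \<theta> by (intro powr_mono) auto
      also have "G powr (real 3) = G ^ 3" using G0 by (rule powr_realpow)
      finally show "G powr (2 + 2 * \<theta>) \<le> G ^ 3" .
    qed auto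
    finally show ?thesis using True by simp
  qed (use G in auto)
  then have "(\<Sum>x\<in>Q. wt x powr (-2 + \<theta>) * of_bool (0 \<le> key x \<and> key x \<le> key q))
     \<le> (G ^ 3 * wt q powr (3 * \<theta>)) * (\<Sum>x\<in>Q. mx (key x) powr (-1 - \<theta>) * mx (oth x) powr (-1 - \<theta>))"
    unfolding sum_distrib_left by (rule sum_mono)
  also have "\<dots> \<le> (G ^ 3 * wt q powr (3 * \<theta>)) * Z ^ 2"
    using assms inj G Z(2)
    by (intro mult_left_mono sum_pair_le[where f = "\<lambda>m. mx m powr (-1 - \<theta>)"]) (auto intro: inj_on_subset)
  finally show ?thesis by (simp add: mult_ac)
qed

text \<open>\<open>uw\<close> with a power \<theta> of the weight given away at every index. A
  single member outside the box converts this reserve into \<open>B powr - \<theta>\<close>.\<close>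

definition vw :: "nat \<Rightarrow> int \<times> int \<Rightarrow> real" where
  "vw i x = (if i = 0 then wt x powr (-3 + \<theta>) else wt x powr (-2 + \<theta>))"

lemma vw_nonneg [simp]: "vw i x \<ge> 0" by (simp add: vw_def)

lemma uw_le_vw: "uw i x \<le> vw i x"
proof -
  have "1 / wt x ^ 3 = wt x powr (-3)" "1 / wt x ^ 2 = wt x powr (-2)"
    by (simp_all add: powr_minus_divide powr_numeral)
  then show ?thesis using \<theta> by (auto simp: uw_def vw_def intro!: powr_mono)
qed

lemma uw_eq_vw: "uw i x = vw i x * wt x powr - \<theta>"
proof -
  have "1 / wt x ^ 3 = wt x powr (-3)" "1 / wt x ^ 2 = wt x powr (-2)"
    by (simp_all add: powr_minus_divide powr_numeral)
  then show ?thesis by (auto simp: uw_def vw_def powr_add [symmetric])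
qed

text \<open>Once \<open>P 0\<close> is fixed the conditions on the other members are independent, so
  their sums factor, each costing \<open>wt (P 0) powr (3 * \<theta>)\<close>.\<close>

lemma sum_strip_tuples:
  assumes "finite Q" "r \<ge> 1" "\<theta> = 1 / (3 * real r)"
  shows "(\<Sum>P\<in>tuples {..<r} Q. (\<Prod>i<r. vw i (P i)) * of_bool (\<forall>i\<in>{1..<r}. 0 \<le> key (P i) \<and> key (P i) \<le> key (P 0)))
       \<le> G ^ (3 * r) * Z ^ (2 * r)"
proof -
  define J where "J = {..<r} - {0}"
  have J: "{..<r} = insert 0 J" "0 \<notin> J" "finite J" "card J = r - 1" "{1..<r} = J" using assms(2) by (auto simp: J_def)
  let ?b = "\<lambda>q x. 0 \<le> key x \<and> key x \<le> key q"
  have "(\<Sum>P\<in>tuples {..<r} Q. (\<Prod>i<r. vw i (P i)) * of_bool (\<forall>i\<in>{1..<r}. ?b (P 0) (P i)))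
     = (\<Sum>P\<in>tuples J Q. \<Sum>x\<in>Q. vw 0 x * (\<Prod>i\<in>J. vw i (P i) * of_bool (?b x (P i))))"
  proof -
    have "(\<Prod>i<r. vw i ((P(0 := x)) i)) * of_bool (\<forall>i\<in>{1..<r}. ?b ((P(0 := x)) 0) ((P(0 := x)) i))
        = vw 0 x * (\<Prod>i\<in>J. vw i (P i) * of_bool (?b x (P i)))" for P x
    proof -
      have "(\<Prod>i\<in>J. of_bool (?b x (P i)) :: real) = of_bool (\<forall>i\<in>J. ?b x (P i))"
        using J(3) by (induction J) auto
      moreover have "(\<forall>i\<in>{1..<r}. ?b ((P(0 := x)) 0) ((P(0 := x)) i)) \<longleftrightarrow> (\<forall>i\<in>J. ?b x (P i))"
        using J(2,5) by auto
      ultimately show ?thesis unfolding J(1) prod_update_insert[OF J(2,3)] prod.distrib by (simp only: mult.assoc)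
    qed
    then show ?thesis unfolding J(1) sum_tuples_insert[OF J(2)] by (simp only: J(1)[symmetric])
  qed
  also have "\<dots> = (\<Sum>x\<in>Q. vw 0 x * (\<Sum>P\<in>tuples J Q. \<Prod>i\<in>J. vw i (P i) * of_bool (?b x (P i))))"
    unfolding sum_distrib_left by (rule sum.swap)
  also have "\<dots> = (\<Sum>x\<in>Q. vw 0 x * (\<Prod>i\<in>J. \<Sum>y\<in>Q. vw i y * of_bool (?b x y)))"
    by (simp only: sum_tuples_prod[OF J(3), where u = "\<lambda>i y. vw i y * of_bool (?b _ y)"])
  also have "\<dots> \<le> (\<Sum>x\<in>Q. vw 0 x * (G ^ 3 * Z ^ 2 * wt x powr (3 * \<theta>)) ^ (r - 1))"
  proof (intro sum_mono mult_left_mono)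
    fix x
    have "(\<Prod>i\<in>J. \<Sum>y\<in>Q. vw i y * of_bool (?b x y)) \<le> (\<Prod>i\<in>J. G ^ 3 * Z ^ 2 * wt x powr (3 * \<theta>))"
    proof (intro prod_mono conjI sum_nonneg)
      fix i assume "i \<in> J"
      then show "(\<Sum>y\<in>Q. vw i y * of_bool (?b x y)) \<le> G ^ 3 * Z ^ 2 * wt x powr (3 * \<theta>)"
        using sum_strip_powr[OF assms(1), of x] J(2) by (cases "i = 0") (auto simp: vw_def)
    qed auto
    then show "(\<Prod>i\<in>J. \<Sum>y\<in>Q. vw i y * of_bool (?b x y)) \<le> (G ^ 3 * Z ^ 2 * wt x powr (3 * \<theta>)) ^ (r - 1)"
      using J(4) by simp
  qed auto
  also have "\<dots> \<le> (\<Sum>x\<in>Q. (G ^ 3 * Z ^ 2) ^ (r - 1) * (mx (fst x) powr (-1 - \<theta>) * mx (snd x) powr (-1 - \<theta>)))"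
  proof (intro sum_mono)
    fix x
    have "(wt x powr (3 * \<theta>)) ^ (r - 1) = wt x powr (3 * \<theta> * real (r - 1))"
      by (simp add: powr_realpow [symmetric] powr_powr)
    then have "vw 0 x * (wt x powr (3 * \<theta>)) ^ (r - 1) = wt x powr ((-3 + \<theta>) + 3 * \<theta> * real (r - 1))"
      by (simp add: vw_def powr_add)
    \<comment> \<open>Here 3 \<theta> r = 1 enters: the total exponent is -2 - 2 \<theta>, just
      enough for convergence over the plane.\<close>
    also have "(-3 + \<theta>) + 3 * \<theta> * real (r - 1) = (-1 - \<theta>) + (-1 - \<theta>)"
      using assms(2,3) by (simp add: of_nat_diff field_simps)
    also have "wt x powr ((-1 - \<theta>) + (-1 - \<theta>)) = wt x powr (-1 - \<theta>) * wt x powr (-1 - \<theta>)"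
      by (rule powr_add)
    also have "\<dots> \<le> mx (fst x) powr (-1 - \<theta>) * mx (snd x) powr (-1 - \<theta>)"
      using \<theta> by (intro mult_mono powr_mono2') auto
    finally have "(G ^ 3 * Z ^ 2) ^ (r - 1) * (vw 0 x * (wt x powr (3 * \<theta>)) ^ (r - 1)) \<le> (G ^ 3 * Z ^ 2) ^ (r - 1) * (mx (fst x) powr (-1 - \<theta>) * mx (snd x) powr (-1 - \<theta>))"
      using G by (intro mult_left_mono) auto
    then show "vw 0 x * (G ^ 3 * Z ^ 2 * wt x powr (3 * \<theta>)) ^ (r - 1) \<le> (G ^ 3 * Z ^ 2) ^ (r - 1) * (mx (fst x) powr (-1 - \<theta>) * mx (snd x) powr (-1 - \<theta>))"
      by (simp only: power_mult_distrib mult_ac)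
  qed
  also have "\<dots> \<le> (G ^ 3 * Z ^ 2) ^ (r - 1) * Z ^ 2"
    unfolding sum_distrib_left [symmetric] using assms(1) G Z(2)
    by (intro mult_left_mono sum_pair_le[where f = "\<lambda>m. mx m powr (-1 - \<theta>)"]) (auto simp: inj_on_def prod_eq_iff)
  also have "\<dots> \<le> (G ^ 3 * Z ^ 2) ^ (r - 1) * (G ^ 3 * Z ^ 2)"
    using G Z(1) by (intro mult_left_mono) auto
  also have "\<dots> = (G ^ 3 * Z ^ 2) ^ r" using assms(2) by (cases r) auto
  also have "\<dots> = G ^ (3 * r) * Z ^ (2 * r)" by (simp add: power_mult_distrib power_mult)
  finally show ?thesis .
qed

end

section \<open>Passing from the infinite sums to the box\<close>

lemma infsum_norm_le:
  fixes f :: "'a \<Rightarrow> 'b::banach"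
  assumes "\<And>F. finite F \<Longrightarrow> F \<subseteq> A \<Longrightarrow> (\<Sum>x\<in>F. norm (f x)) \<le> K"
  shows "f summable_on A" "norm (infsum f A) \<le> K"
proof -
  have abs: "f abs_summable_on A"
    using assms by (intro nonneg_bdd_above_summable_on bdd_aboveI[of _ K]) auto
  then show "f summable_on A" by (rule abs_summable_summable)
  have "norm (infsum f A) \<le> infsum (\<lambda>x. norm (f x)) A" using abs by (rule norm_infsum_bound)
  also have "\<dots> \<le> K" using abs assms by (intro infsum_le_finite_sums) auto
  finally show "norm (infsum f A) \<le> K" .
qed

definition chain_tuples :: "(int \<times> int \<Rightarrow> bool) \<Rightarrow> nat \<Rightarrow> (nat \<Rightarrow> int \<times> int) set" where
  "chain_tuples R r = {P \<in> tuples {..<r} UNIV. cone_chain R r P}"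

context lattice_weights
begin

lemma infsum_truncate:
  assumes "strip_sum key oth G \<theta> Z" and \<theta>: "\<theta> = 1 / (3 * real r)"
    and key: "\<And>x y. key (x - y) = key x - key y" "\<And>d. R d \<Longrightarrow> key d \<ge> 0" "\<And>d e. R d \<Longrightarrow> R e \<Longrightarrow> R (d + e)"
  shows "norm (infsum (summand {..<r}) (chain_tuples R r) - (\<Sum>P\<in>tuples {..<r} (int_box B). summand {..<r} P * of_bool (cone_chain R r P)))
     \<le> CK * (G ^ (3 * r) * Z ^ (2 * r)) * real_of_int B powr - \<theta>"
proof -
  interpret S: strip_sum key oth G \<theta> Z by fact
  let ?A = "chain_tuples R r" and ?K = "CK * (G ^ (3 * r) * Z ^ (2 * r))" and ?f = "summand {..<r}"
  have B0: "real_of_int B > 0" using B_ge by linarith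
  have fin: "(\<Sum>P\<in>F. CK * (\<Prod>i<r. S.vw i (P i))) \<le> ?K" if F: "finite F" "F \<subseteq> ?A" for F
  proof -
    \<comment> \<open>All entries occurring in the finite family; this embeds \<open>F\<close> into
      a product set, where the sum factors.\<close>
    define Q where "Q = (\<Union>P\<in>F. P ` {..<r})"
    have Q: "finite Q" using F by (simp add: Q_def)
    have sub: "F \<subseteq> tuples {..<r} Q"
      using F(2) by (auto simp: chain_tuples_def tuples_def Q_def)
    have strip: "0 \<le> key (P i) \<and> key (P i) \<le> key (P 0)" if "P \<in> F" "i \<in> {1..<r}" for P i
    proof -
      have P: "cone_chain R r P" "P r = 0" using that F(2) by (auto simp: chain_tuples_def tuples_def)
      have "R (P i - P r)" "R (P 0 - P i)"
        using that P(1) by (auto intro!: chain_less[of R r P] key(3))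
      then show ?thesis using key(1)[of "P i" 0] key(1)[of 0 0] key(1)[of "P 0" "P i"] key(2) P(2) by fastforce
    qed
    have "(\<Sum>P\<in>F. \<Prod>i<r. S.vw i (P i)) = (\<Sum>P\<in>F. (\<Prod>i<r. S.vw i (P i)) * of_bool (\<forall>i\<in>{1..<r}. 0 \<le> key (P i) \<and> key (P i) \<le> key (P 0)))"
      using strip by (intro sum.cong) auto
    also have "\<dots> \<le> (\<Sum>P\<in>tuples {..<r} Q. (\<Prod>i<r. S.vw i (P i)) * of_bool (\<forall>i\<in>{1..<r}. 0 \<le> key (P i) \<and> key (P i) \<le> key (P 0)))"
      by (intro sum_mono2 finite_tuples Q sub mult_nonneg_nonneg prod_nonneg) auto
    also have "\<dots> \<le> G ^ (3 * r) * Z ^ (2 * r)" by (rule S.sum_strip_tuples[OF Q r \<theta>])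
    finally show ?thesis unfolding sum_distrib_left[symmetric] using CK_ge_1 by (intro mult_left_mono) auto
  qed
  have bound: "norm (?f P) \<le> CK * (\<Prod>i<r. S.vw i (P i))" for P
  proof -
    have "norm (?f P) \<le> CK * (\<Prod>i<r. uw i (P i))" by (rule norm_tm_le) simp
    also have "\<dots> \<le> CK * (\<Prod>i<r. S.vw i (P i))"
      using CK_ge_1 by (intro mult_left_mono prod_mono) (auto simp: S.uw_le_vw)
    finally show ?thesis .
  qed
  have summ: "?f summable_on ?A"
  proof (rule infsum_norm_le(1))
    fix F assume "finite F" "F \<subseteq> ?A"
    then show "(\<Sum>P\<in>F. norm (?f P)) \<le> ?K" using fin[of F] sum_mono[of F "\<lambda>P. norm (?f P)", OF bound] by linarith
  qed
  have tail: "norm (infsum ?f (?A - tuples {..<r} (int_box B))) \<le> ?K * real_of_int B powr - \<theta>"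
  proof (rule infsum_norm_le(2))
    fix F assume F: "finite F" "F \<subseteq> ?A - tuples {..<r} (int_box B)"
    have "(\<Sum>P\<in>F. norm (?f P)) \<le> (\<Sum>P\<in>F. CK * (\<Prod>i<r. S.vw i (P i)) * real_of_int B powr - \<theta>)"
    proof (rule sum_mono)
      fix P assume "P \<in> F"
      then obtain j where j: "j < r" "P j \<notin> int_box B"
        using F(2) by (fastforce simp: chain_tuples_def tuples_def)
      then have w: "real_of_int B \<le> wt (P j)" using in_box_iff[OF B_ge(2), of "P j"] by linarith
      have "norm (?f P) \<le> CK * (\<Prod>i<r. uw i (P i))" by (rule norm_tm_le) simp
      also have "(\<Prod>i<r. uw i (P i)) = uw j (P j) * (\<Prod>i\<in>{..<r} - {j}. uw i (P i))"
        using j by (intro prod.remove) auto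
      also have "CK * \<dots> \<le> CK * ((S.vw j (P j) * real_of_int B powr - \<theta>) * (\<Prod>i\<in>{..<r} - {j}. S.vw i (P i)))"
      proof (intro mult_left_mono mult_mono prod_mono prod_nonneg)
        show "uw j (P j) \<le> S.vw j (P j) * real_of_int B powr - \<theta>"
          unfolding S.uw_eq_vw using w B0 S.\<theta> by (intro mult_left_mono powr_mono2') auto
      qed (use CK_ge_1 in \<open>auto simp: S.uw_le_vw\<close>)
      also have "\<dots> = CK * (\<Prod>i<r. S.vw i (P i)) * real_of_int B powr - \<theta>"
        using j prod.remove[of "{..<r}" j "\<lambda>i. S.vw i (P i)"] by simp
      finally show "norm (?f P) \<le> CK * (\<Prod>i<r. S.vw i (P i)) * real_of_int B powr - \<theta>" .
    qed
    also have "\<dots> \<le> ?K * real_of_int B powr - \<theta>"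
      unfolding sum_distrib_right [symmetric] using F by (intro mult_right_mono fin) auto
    finally show "(\<Sum>P\<in>F. norm (?f P)) \<le> ?K * real_of_int B powr - \<theta>" .
  qed
  have finB: "finite (tuples {..<r} (int_box B))" by (intro finite_tuples) auto
  have "infsum ?f ?A = infsum ?f ((?A \<inter> tuples {..<r} (int_box B)) \<union> (?A - tuples {..<r} (int_box B)))"
    by (simp only: Int_Diff_Un)
  also have "\<dots> = infsum ?f (?A \<inter> tuples {..<r} (int_box B)) + infsum ?f (?A - tuples {..<r} (int_box B))"
    by (intro infsum_Un_disjoint summable_on_subset_banach[OF summ]) auto
  also have "infsum ?f (?A \<inter> tuples {..<r} (int_box B)) = (\<Sum>P\<in>?A \<inter> tuples {..<r} (int_box B). ?f P)"
    using finB by (intro infsum_finite) auto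
  also have "\<dots> = (\<Sum>P\<in>tuples {..<r} (int_box B). ?f P * of_bool (cone_chain R r P))"
    using finB by (intro sum.mono_neutral_cong_left) (auto simp: chain_tuples_def tuples_def)
  finally show ?thesis using tail by simp
qed

end

section \<open>The main theorem\<close>

lemma powr_minus_power_root:
  assumes "x > 0" "m > 0"
  shows "(x ^ (m * n)) powr - (1 / real m) = 1 / x ^ n"
proof -
  have "(x ^ (m * n)) powr - (1 / real m) = x powr (real (m * n) * - (1 / real m))"
    using assms by (simp only: powr_realpow [symmetric] powr_powr)
  also have "real (m * n) * - (1 / real m) = - real n" using assms by simp
  finally show ?thesis using assms by (simp add: powr_minus_divide powr_realpow)
qed

lemma harm_le_ln: "n \<ge> 1 \<Longrightarrow> harm n \<le> 1 + ln (real n)"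
proof -
  assume "n \<ge> 1"
  then obtain m where "n = Suc m" by (cases n) auto
  moreover have "harm (Suc m) - ln (Suc m) \<le> harm (Suc 0) - ln (Suc 0 :: nat)"
    using decseq_harm_diff_ln by (rule decseqD) auto
  ultimately show ?thesis by (simp add: harm_expand)
qed

lemma hs_le:
  assumes "B \<ge> 1"
  shows "hs B \<le> 3 + 2 * ln (2 * real_of_int B)"
proof -
  define n where "n = nat (2 * B)"
  have n: "int n = 2 * B" "n \<ge> 1" using assms by (auto simp: n_def)
  have "hs B = (\<Sum>m\<in>{-int n..int n}. 1 / mx m)" unfolding hs_def n(1) by simp
  also have "{-int n..int n} = insert 0 (int ` {1..n} \<union> (\<lambda>k. - int k) ` {1..n})"
  proof (intro equalityI subsetI)
    fix m assume "m \<in> {-int n..int n}"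
    then have "m = 0 \<or> m = int (nat m) \<and> nat m \<in> {1..n} \<or> m = - int (nat (- m)) \<and> nat (- m) \<in> {1..n}" by auto
    then show "m \<in> insert 0 (int ` {1..n} \<union> (\<lambda>k. - int k) ` {1..n})" by blast
  qed auto
  also have "(\<Sum>m\<in>\<dots>. 1 / mx m) = 1 + ((\<Sum>m\<in>int ` {1..n}. 1 / mx m) + (\<Sum>m\<in>(\<lambda>k. - int k) ` {1..n}. 1 / mx m))"
    by (subst sum.insert; (subst sum.union_disjoint)?) (auto simp: mx_def)
  also have "(\<Sum>m\<in>int ` {1..n}. 1 / mx m) = harm n"
    unfolding harm_def by (subst sum.reindex) (auto simp: mx_def max_def inverse_eq_divide intro!: sum.cong)
  also have "(\<Sum>m\<in>(\<lambda>k. - int k) ` {1..n}. 1 / mx m) = harm n"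
    unfolding harm_def by (subst sum.reindex) (auto simp: mx_def max_def inverse_eq_divide inj_on_def intro!: sum.cong)
  also have "1 + (harm n + harm n) \<le> 3 + 2 * ln (real n)"
    using harm_le_ln[OF n(2)] by simp
  also have "real n = 2 * real_of_int B" using n(1) by (metis of_int_mult of_int_numeral of_int_of_nat_eq)
  finally show ?thesis .
qed

lemma log_factor_ge: "t \<ge> 0 \<Longrightarrow> log_factor t \<ge> 1"
  by (simp add: log_factor_def)

text \<open>A power of N has logarithm O(log N). The 5 is 3 + 2 with 2 ln 2 bounded by 2.\<close>

lemma hs_power_le:
  assumes "N \<ge> 1"
  shows "hs (int N ^ K) \<le> (5 + 2 * real K) * log_factor (real N)"
proof -
  have "ln (2 * real N ^ K) = ln 2 + real K * ln (real N)"
    using assms by (subst ln_mult) (auto simp: ln_realpow)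
  moreover have "ln 2 \<le> (1 :: real)" using ln_le_minus_one[of 2] by simp
  moreover have "ln (real N) \<le> log_factor (real N)"
  proof -
    have "ln (real N) \<le> ln (2 + real N)" using assms by (subst ln_le_cancel_iff) auto
    then show ?thesis unfolding log_factor_def by linarith
  qed
  then have "real K * ln (real N) \<le> real K * log_factor (real N)" by (intro mult_left_mono) auto
  moreover have "hs (int N ^ K) \<le> 3 + 2 * ln (2 * real N ^ K)"
    using hs_le[of "int N ^ K"] assms by simp
  ultimately show ?thesis using log_factor_ge[of "real N"] by (simp add: algebra_simps)
qed

section \<open>From lists of lattice points to coordinate tuples\<close>

lemma infsum_chains:
  assumes \<tau>: "Im \<tau> > 0"
    and gt: "\<And>p q. gt (lam \<tau> p) (lam \<tau> q) \<longleftrightarrow> R (p - q)"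
  shows "(\<Sum>\<^sub>\<infinity>ls\<in>chains gt \<tau> r. f ls) = (\<Sum>\<^sub>\<infinity>P\<in>chain_tuples R r. f (map (\<lambda>i. lam \<tau> (P i)) [0..<r]))"
proof -
  let ?h = "\<lambda>P. map (\<lambda>i. lam \<tau> (P i)) [0..<r]"
  have lam_inj: "p = q" if "lam \<tau> p = lam \<tau> q" for p q
    using that by (simp add: lam_def lattice_point_eq_iff[OF \<tau>] prod_eq_iff)
  have cone_chain: "successively gt (?h P @ [0]) \<longleftrightarrow> cone_chain R r P" if "P r = 0" for P
  proof -
    have nth: "(?h P @ [0]) ! i = lam \<tau> (P i)" if "i \<le> r" for i
      using that \<open>P r = 0\<close> by (cases "i = r") (auto simp: nth_append)
    have "successively gt (?h P @ [0]) \<longleftrightarrow> (\<forall>i<r. gt ((?h P @ [0]) ! i) ((?h P @ [0]) ! Suc i))"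
      by (simp add: successively_conv_nth)
    also have "\<dots> \<longleftrightarrow> cone_chain R r P"
      unfolding cone_chain_def by (intro all_cong imp_cong refl) (simp only: nth less_imp_le_nat Suc_leI gt)
    finally show ?thesis .
  qed
  have "chains gt \<tau> r = ?h ` chain_tuples R r"
  proof (intro equalityI subsetI)
    fix ls assume "ls \<in> chains gt \<tau> r"
    then have ls: "length ls = r" "set ls \<subseteq> lattice \<tau>" "successively gt (ls @ [0])"
      by (auto simp: chains_def)
    have "\<exists>p. ls ! i = lam \<tau> p" if "i < r" for i
    proof -
      have "ls ! i \<in> lattice \<tau>" using ls that nth_mem by blast
      then obtain a b where "ls ! i = lattice_point \<tau> a b" by (auto simp: lattice_def)
      then show ?thesis by (intro exI[of _ "(a, b)"]) (simp add: lam_def)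
    qed
    then obtain p where p: "\<And>i. i < r \<Longrightarrow> ls ! i = lam \<tau> (p i)" by metis
    define P where "P i = (if i < r then p i else 0)" for i
    have "ls = ?h P" using ls(1) p by (intro nth_equalityI) (auto simp: P_def)
    moreover have "P \<in> chain_tuples R r"
      using ls(3) cone_chain[of P] \<open>ls = ?h P\<close> by (auto simp: chain_tuples_def tuples_def P_def)
    ultimately show "ls \<in> ?h ` chain_tuples R r" by blast
  next
    fix ls assume "ls \<in> ?h ` chain_tuples R r"
    then obtain P where P: "ls = ?h P" "P \<in> chain_tuples R r" by blast
    then have "successively gt (ls @ [0])" using cone_chain[of P] by (auto simp: chain_tuples_def tuples_def)
    then show "ls \<in> chains gt \<tau> r" using P(1) by (auto simp: chains_def lattice_def lam_def)
  qed
  moreover have "inj_on ?h (chain_tuples R r)"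
  proof (rule inj_onI)
    fix P P' assume P: "P \<in> chain_tuples R r" "P' \<in> chain_tuples R r" "?h P = ?h P'"
    show "P = P'"
    proof
      fix i show "P i = P' i"
      proof (cases "i < r")
        case True
        then have "?h P ! i = ?h P' ! i" using P(3) by simp
        then show ?thesis using True lam_inj by simp
      qed (use P in \<open>auto simp: chain_tuples_def tuples_def\<close>)
    qed
  qed
  ultimately show ?thesis by (simp add: infsum_reindex o_def)
qed

lemma chain_orders:
  assumes "Im \<tau> > 0"
  shows "lattice_gt \<tau> (lam \<tau> p) (lam \<tau> q) \<longleftrightarrow> pos0 (p - q)"
    and "lattice_gtN N \<tau> (lam \<tau> p) (lam \<tau> q) \<longleftrightarrow> posN N (p - q)"
  unfolding lam_def lattice_gt_iff[OF assms] lattice_gtN_iff[OF assms] 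
  by (auto simp: pos0_def posN_def height_def algebra_simps)

text \<open>The imaginary part controls the first coordinate through the minimum of
  \<open>Im\<close> on \<open>C\<close>; the second is then recovered from b = \<lambda> - a \<tau>
  and a bound for |\<tau>|.\<close>

lemma compact_lattice_bounds:
  assumes "compact C" "C \<subseteq> upper_half_plane"
  obtains c C0 where "0 < c" "\<And>\<tau>. \<tau> \<in> C \<Longrightarrow> lattice_bounds \<tau> c C0"
proof (cases "C = {}")
  case False
  have "continuous_on C Im" by (intro continuous_intros)
  then obtain \<tau>0 where \<tau>0: "\<tau>0 \<in> C" "\<And>\<tau>. \<tau> \<in> C \<Longrightarrow> Im \<tau>0 \<le> Im \<tau>"
    using continuous_attains_inf[OF assms(1) False, of Im] by blast
  define m where "m = Im \<tau>0"
  have m: "m > 0" using \<tau>0(1) assms(2) by (auto simp: m_def upper_half_plane_def)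
  obtain L where L: "\<And>\<tau>. \<tau> \<in> C \<Longrightarrow> norm \<tau> \<le> L"
    using compact_imp_bounded[OF assms(1)] by (auto simp: bounded_iff)
  have L0: "L \<ge> 0" using L[OF \<tau>0(1)] norm_ge_zero[of \<tau>0] by linarith
  define c where "c = min 1 (min m (1 / (1 + L / m)))"
  have c: "0 < c" "c \<le> 1" "c \<le> m" "c \<le> 1 / (1 + L / m)"
    using m L0 by (auto simp: c_def add_pos_nonneg)
  have "lattice_bounds \<tau> c (L + 1)" if \<tau>: "\<tau> \<in> C" for \<tau>
  proof
    fix p :: "int \<times> int"
    let ?a = "real_of_int (fst p)" and ?b = "real_of_int (snd p)" and ?l = "norm (lam \<tau> p)"
    have lam: "lam \<tau> p = ?a * \<tau> + ?b" by (simp add: lam_def lattice_point_def)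
    have "?l \<le> \<bar>?a\<bar> * norm \<tau> + \<bar>?b\<bar>"
      unfolding lam using norm_triangle_ineq[of "?a * \<tau>" "of_real ?b"] by (simp add: norm_mult)
    also have "\<dots> \<le> wt p * L + wt p"
      using L[OF \<tau>] by (intro add_mono mult_mono abs_le_wt) auto
    finally show "?l \<le> (L + 1) * wt p" by (simp add: algebra_simps)
    have "\<bar>?a\<bar> * m \<le> \<bar>?a\<bar> * Im \<tau>" using \<tau>0(2)[OF \<tau>] by (intro mult_left_mono) (auto simp: m_def)
    also have "\<dots> = \<bar>Im (lam \<tau> p)\<bar>" using \<tau>0(2)[OF \<tau>] m by (simp add: lam abs_mult m_def)
    also have "\<dots> \<le> ?l" by (rule abs_Im_le_cmod)
    finally have a: "\<bar>?a\<bar> * m \<le> ?l" .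
    have "norm (of_real ?b :: complex) \<le> ?l + norm (?a * \<tau>)"
      unfolding lam using norm_triangle_ineq4[of "?a * \<tau> + ?b" "?a * \<tau>"] by simp
    also have "\<dots> \<le> ?l + \<bar>?a\<bar> * L" using L[OF \<tau>] by (simp add: norm_mult mult_left_mono)
    also have "\<dots> \<le> ?l + (?l / m) * L"
    proof (intro add_left_mono mult_right_mono)
      show "\<bar>?a\<bar> \<le> ?l / m" using a m by (simp only: pos_le_divide_eq)
    qed (rule L0)
    also have "\<dots> = ?l * (1 + L / m)" by (simp only: distrib_left mult_1_right times_divide_eq_left times_divide_eq_right)
    finally have b: "\<bar>?b\<bar> \<le> ?l * (1 + L / m)" by (simp only: norm_of_real)
    \<comment> \<open>A nonzero integer coordinate makes the cutoff in \<open>wt\<close> inactive;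
      at 0, where \<open>wt\<close> is 1, the lower bound would fail.\<close>
    assume "p \<noteq> 0"
    then have "fst p \<noteq> 0 \<or> snd p \<noteq> 0" by (auto simp: prod_eq_iff)
    then have "1 \<le> \<bar>?a\<bar> \<or> 1 \<le> \<bar>?b\<bar>" by linarith
    then have "wt p = max \<bar>?a\<bar> \<bar>?b\<bar>" by (auto simp: wt_def mx_def max_def)
    moreover have "c * \<bar>?a\<bar> \<le> ?l"
      using a c(3) mult_right_mono[of c m "\<bar>?a\<bar>"] by (simp add: mult.commute)
    moreover have "c * \<bar>?b\<bar> \<le> ?l"
    proof -
      have "c * \<bar>?b\<bar> \<le> (1 / (1 + L / m)) * (?l * (1 + L / m))"
        using c(1,4) b m L0 by (intro mult_mono) simp_all
      also have "\<dots> = ?l"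
      proof -
        have "1 + L / m \<noteq> 0" using m L0 by (intro less_imp_neq[THEN not_sym] add_pos_nonneg) auto
        then show ?thesis by simp
      qed
      finally show ?thesis .
    qed
    ultimately show "c * wt p \<le> ?l" by (simp only: max_def split: if_split) blast
  qed (use c in auto)
  with c(1) show ?thesis by (rule that)
qed (use that[of 1 0] in simp)

lemma strip_sum_pos0:
  assumes "N \<ge> 1" "0 < \<theta>" "\<theta> \<le> 1 / 3" "Z \<ge> 1" "\<And>M. finite M \<Longrightarrow> (\<Sum>m\<in>M. mx m powr (-1 - \<theta>)) \<le> Z"
  shows "strip_sum fst snd (2 * real N) \<theta> Z"
proof
  fix x :: "int \<times> int"
  have "1 * wt x \<le> 2 * real N * wt x" using assms(1) by (intro mult_right_mono) auto
  then show "mx (fst x) \<le> 2 * real N * wt x" "mx (snd x) \<le> 2 * real N * wt x"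
    using wt_ge(2,3)[of x] by linarith+
qed (use assms in \<open>auto simp: inj_def\<close>)

text \<open>The height can be of size 2 N times the weight; this distortion is the source of the
  power N ^ (3 * r) in the tail. The lexicographic order is given the same constant so that both
  errors have one form.\<close>

lemma strip_sum_posN:
  assumes "N \<ge> 1" "0 < \<theta>" "\<theta> \<le> 1 / 3" "Z \<ge> 1" "\<And>M. finite M \<Longrightarrow> (\<Sum>m\<in>M. mx m powr (-1 - \<theta>)) \<le> Z"
  shows "strip_sum (\<lambda>x. height N (fst x) (snd x)) fst (2 * real N) \<theta> Z"
proof
  fix x :: "int \<times> int"
  have a: "1 * wt x \<le> real N * wt x" using assms(1) by (intro mult_right_mono) auto
  then show "mx (fst x) \<le> 2 * real N * wt x" using wt_ge(2,4)[of x] by linarith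
  note f = abs_le_wt[of x]
  have "\<bar>real N * real_of_int (fst x)\<bar> \<le> real N * wt x"
    unfolding abs_mult using f(1) by (intro mult_mono) auto
  then have "\<bar>real N * real_of_int (fst x) + real_of_int (snd x)\<bar> \<le> 2 * (real N * wt x)"
    using f(2) a by linarith
  moreover have "1 \<le> 2 * (real N * wt x)" using a wt_ge(1)[of x] by linarith
  ultimately show "mx (height N (fst x) (snd x)) \<le> 2 * real N * wt x" by (simp add: mx_def height_def)
qed (use assms in \<open>auto simp: inj_def height_def\<close>)

theorem theorem3p3:
  fixes r :: nat and ks :: "nat list"
  assumes "r \<ge> 1" and "length ks = r"
    and "ks ! 0 \<ge> 3"
    and "\<And>i. 1 \<le> i \<Longrightarrow> i < r \<Longrightarrow> ks ! i \<ge> 2"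
  shows "\<exists>M::real. M \<ge> 0 \<and>
    (\<forall>C. compact C \<and> C \<subseteq> upper_half_plane \<longrightarrow>
      (\<exists>A::real. A > 0 \<and>
        (\<forall>\<tau>\<in>C. \<forall>N::nat. N \<ge> 1 \<longrightarrow>
           norm (multiple_Eisenstein_N N ks \<tau> - multiple_Eisenstein ks \<tau>)
             \<le> A * log_factor (real N) powr M / (real N)\<^sup>2)))"
proof -
  \<comment> \<open>Each of the \<open>r - 1\<close> inner sums costs a factor \<open>|\<lambda>\<^sub>1| powr (3 * \<theta>)\<close>; together they stay below the
    exponent \<open>1\<close> that the sum of \<open>|\<lambda>\<^sub>1|\<^sup>-\<^sup>3\<close> leaves to spare.\<close>
  define \<theta> where "\<theta> = 1 / (3 * real r)"
  have \<theta>: "0 < \<theta>" "\<theta> \<le> 1 / 3" using assms(1) by (auto simp: \<theta>_def field_simps)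
  obtain Z where Z: "Z \<ge> 1" "\<And>M. finite M \<Longrightarrow> (\<Sum>m\<in>M. mx m powr (-1 - \<theta>)) \<le> Z"
    using sum_mx_powr_bounded[OF \<theta>(1)] by blast
  \<comment> \<open>With \<open>B = N^K\<close> the gain \<open>B powr - \<theta>\<close> beats the loss \<open>N ^ (3 * r)\<close> of the crude tail bound by \<open>N\<^sup>2\<close>.\<close>
  define K where "K = 3 * r * (3 * r + 2)"
  define k where "k i = ks ! i" for i
  show ?thesis
  \<comment> \<open>The weighted tuple sums contribute \<open>2 * r\<close> logarithms and the
    cancellation estimate two more.\<close>
  proof (rule exI[of _ "real (2 * r + 2)"], intro conjI allI impI)
    fix C assume C: "compact C \<and> C \<subseteq> upper_half_plane"
    then have "compact C" "C \<subseteq> upper_half_plane" by blast+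
    then obtain c C0 where c: "0 < c" and bounds: "\<And>\<tau>. \<tau> \<in> C \<Longrightarrow> lattice_bounds \<tau> c C0"
      by (rule compact_lattice_bounds) (rule that)
    define CB' where "CB' = lattice_weights.CB c C0 r k"
    define CK' where "CK' = lattice_weights.CK c r k"
    \<comment> \<open>The box difference, the two truncation errors, and 1 to make the constant
      positive. \<open>CB'\<close> and \<open>CK'\<close> depend on \<open>c\<close>,
      \<open>C0\<close>, \<open>r\<close> and \<open>k\<close> only, hence neither on N nor on the
      point \<tau> of \<open>C\<close>.\<close>
    define A where "A = \<bar>CB'\<bar> * (5 + 2 * real K) ^ (2 * r + 2) + 2 * (\<bar>CK'\<bar> * (2 ^ (3 * r) * Z ^ (2 * r))) + 1"
    have "A > 0" unfolding A_def using Z(1) by (intro add_nonneg_pos add_nonneg_nonneg mult_nonneg_nonneg) auto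
    moreover have "norm (multiple_Eisenstein_N N ks \<tau> - multiple_Eisenstein ks \<tau>)
             \<le> A * log_factor (real N) powr real (2 * r + 2) / (real N)\<^sup>2" if \<tau>: "\<tau> \<in> C" and N: "N \<ge> 1" for \<tau> N
    proof -
      define B where "B = int N ^ K"
      have "3 * 1 * 1 \<le> K" unfolding K_def using assms(1) by (intro mult_le_mono) auto
      then have NB: "int N ^ 3 \<le> B" unfolding B_def using N by (intro power_increasing) auto
      interpret lattice_weights \<tau> c C0 N B r k
      proof (intro lattice_weights.intro lattice_box.intro bounds \<tau>)
        show "lattice_box_axioms N B" using N NB by unfold_locales
        show "lattice_weights_axioms r k"
          using assms by unfold_locales (auto simp: k_def)
      qed
      have Im: "Im \<tau> > 0" using \<tau> C by (auto simp: upper_half_plane_def)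
      let ?X = "CK * ((2 * real N) ^ (3 * r) * Z ^ (2 * r)) * real_of_int B powr - \<theta>"
      have summand: "1 / (\<Prod>i<length ks. (map (\<lambda>i. lam \<tau> (P i)) [0..<length ks] ! i) ^ (ks ! i)) = summand {..<r} P" for P
        unfolding summand_def k_def assms(2) by (simp add: prod_dividef)
      have E: "multiple_Eisenstein ks \<tau> = infsum (summand {..<r}) (chain_tuples pos0 r)"
        unfolding multiple_Eisenstein_def infsum_chains[where gt = "lattice_gt \<tau>" and R = pos0, OF Im chain_orders(1)[OF Im]] summand by (simp only: assms(2))
      have EN: "multiple_Eisenstein_N N ks \<tau> = infsum (summand {..<r}) (chain_tuples (posN N) r)"
        unfolding multiple_Eisenstein_N_def infsum_chains[where gt = "lattice_gtN N \<tau>" and R = "posN N", OF Im chain_orders(2)[OF Im]] summand by (simp only: assms(2))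
      let ?S = "\<lambda>R. \<Sum>P\<in>tuples {..<r} (int_box B). summand {..<r} P * of_bool (cone_chain R r P)"
      have 1: "norm (multiple_Eisenstein ks \<tau> - ?S pos0) \<le> ?X"
        unfolding E by (rule infsum_truncate[OF strip_sum_pos0[OF N \<theta> Z] \<theta>_def]) (auto simp: pos0_def)
      have 2: "norm (multiple_Eisenstein_N N ks \<tau> - ?S (posN N)) \<le> ?X"
        unfolding EN by (rule infsum_truncate[OF strip_sum_posN[OF N \<theta> Z] \<theta>_def])
          (auto simp: posN_def height_def algebra_simps)
      have "?S (posN N) - ?S pos0 = (\<Sum>P\<in>tuples {..<r} (int_box B). summand {..<r} P * gap r P)"
        by (simp add: gap_def algebra_simps sum_subtractf)
      then have 3: "norm (?S (posN N) - ?S pos0) \<le> CB * hs B ^ (2 * r + 2) / N^2" 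
        using sum_box_gap by simp
      have "multiple_Eisenstein_N N ks \<tau> - multiple_Eisenstein ks \<tau> =
         (multiple_Eisenstein_N N ks \<tau> - ?S (posN N)) + (?S (posN N) - ?S pos0) - (multiple_Eisenstein ks \<tau> - ?S pos0)"
        by simp
      then have "norm (multiple_Eisenstein_N N ks \<tau> - multiple_Eisenstein ks \<tau>) \<le> 
         norm (multiple_Eisenstein_N N ks \<tau> - ?S (posN N)) + norm (?S (posN N) - ?S pos0) + norm (multiple_Eisenstein ks \<tau> - ?S pos0)"
        by (simp only:) (rule order.trans[OF norm_triangle_ineq4 add_right_mono[OF norm_triangle_ineq]])
      also have "\<dots> \<le> ?X + CB * hs B ^ (2 * r + 2) / N^2 + ?X"
        using 1 2 3 by linarith
      finally have main: "norm (multiple_Eisenstein_N N ks \<tau> - multiple_Eisenstein ks \<tau>) \<le> CB * hs B ^ (2 * r + 2) / N^2 + 2 * ?X" by linarith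
      let ?L = "log_factor (real N)"
      have L: "?L \<ge> 1" by (rule log_factor_ge) simp
      have "CB * hs B ^ (2 * r + 2) \<le> \<bar>CB\<bar> * ((5 + 2 * real K) * ?L) ^ (2 * r + 2)"
        unfolding B_def by (intro mult_mono power_mono hs_power_le N) auto
      then have m1: "CB * hs B ^ (2 * r + 2) / N^2 \<le> \<bar>CB\<bar> * (5 + 2 * real K) ^ (2 * r + 2) * ?L ^ (2 * r + 2) / N^2"
        by (intro divide_right_mono) (auto simp: power_mult_distrib mult_ac)
      have "real_of_int B powr - \<theta> = 1 / real N ^ (3 * r + 2)"
        using powr_minus_power_root[of "real N" "3 * r" "3 * r + 2"] N assms(1)
        by (simp add: B_def K_def \<theta>_def)
      then have "?X = CK * (2 ^ (3 * r) * Z ^ (2 * r)) / N^2"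
        using N by (simp add: power_mult_distrib power_add power2_eq_square)
      also have "\<dots> \<le> (\<bar>CK\<bar> * (2 ^ (3 * r) * Z ^ (2 * r))) * ?L ^ (2 * r + 2) / N^2"
      proof (intro divide_right_mono)
        have "CK * (2 ^ (3 * r) * Z ^ (2 * r)) * 1 \<le> \<bar>CK\<bar> * (2 ^ (3 * r) * Z ^ (2 * r)) * ?L ^ (2 * r + 2)"
          using Z(1) L by (intro mult_mono mult_nonneg_nonneg one_le_power) auto
        then show "CK * (2 ^ (3 * r) * Z ^ (2 * r)) \<le> \<bar>CK\<bar> * (2 ^ (3 * r) * Z ^ (2 * r)) * ?L ^ (2 * r + 2)" by simp
      qed auto
      finally have m2: "?X \<le> (\<bar>CK\<bar> * (2 ^ (3 * r) * Z ^ (2 * r))) * ?L ^ (2 * r + 2) / N^2" .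
      have "norm (multiple_Eisenstein_N N ks \<tau> - multiple_Eisenstein ks \<tau>) \<le> (A - 1) * ?L ^ (2 * r + 2) / N^2"
        using main m1 m2 unfolding A_def CB'_def CK'_def
        by (simp add: distrib_right add_divide_distrib)
      also have "\<dots> \<le> A * ?L ^ (2 * r + 2) / N^2"
        using L by (intro divide_right_mono mult_right_mono) auto
      also have "?L ^ (2 * r + 2) = ?L powr real (2 * r + 2)"
        using L by (intro powr_realpow [symmetric]) auto
      finally show ?thesis by (simp only: of_nat_power)
    qed
    ultimately show "\<exists>A>0. \<forall>\<tau>\<in>C. \<forall>N\<ge>1. norm (multiple_Eisenstein_N N ks \<tau> - multiple_Eisenstein ks \<tau>)
             \<le> A * log_factor (real N) powr real (2 * r + 2) / (real N)\<^sup>2" by blast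
  qed simp
qed

end
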